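(* Let $\langle S,R,T,s_I\rangle$ be a discrete-time Markov chain with goal set $G\subseteq S$ such that the reachability reward $E_{\diamond G}=\mathbb{E}(\mathit{PR})$ is finite. Then the procedure DKW-$\mathbb{E}$-Lower, applied to independent samples of the path reward $\mathit{PR}$, gives limit-PAC lower bounds on $E_{\diamond G}$.
   Context: **Discrete-time Markov chain (DTMC).** A tuple $\langle S,R,T,s_I\rangle$ with a finite set of states $S$, a reward function $R:S\to\mathbb{R}_{\ge0}$, an initial state $s_I\in S$, and a transition function $T$ mapping each state to a probability distribution over $S$. A path is an infinite sequence $\pi=s_0s_1\ldots\in S^\omega$ with $s_0=s_I$ and $T(s_i)(s_{i+1})>0$ for all $i$; write $\pi[i]=s_i$. The DTMC induces the usual probability measure $\mathbb{P}$ on sets of paths; $\mathbb{E}$ is expectation with respect to $\mathbb{P}$. **Reachability reward.** $\mathit{idx}(\pi,G)=\min\{i\in\mathbb{N}\mid s_i\in G\}$, with $\mathit{idx}(\pi,G)=\infty$ if $\pi$ never visits $G$. $\mathit{PR}(\pi)=\sum_{i=0}^{\mathit{idx}(\pi,G)}R(\pi[i])$ and $E_{\diamond G}=\mathbb{E}(\mathit{PR})$, where by convention $E_{\diamond G}=\infty$ if $\mathbb{P}(\{\pi\mid\mathit{idx}(\pi,G)=\infty\})>0$. **The procedure DKW-$\mathbb{E}$-Lower.** Input: a finite nonempty collection $\Xi=(X_1,\dots,X_k)$ of samples in $[0,\infty)$, $k=|\Xi|$, and a confidence level $\gamma\in(0,1)$. Put $\chi_k=\sqrt{\ln\left(\tfrac{2}{1-\gamma}\right)/(2k)}$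 and let $F_\Xi(x)=\frac1k\,|\{i : X_i\le x\}|$ be the empirical cumulative distribution function (cdf). The output $\mathcal{A}(\Xi,\gamma)$ is the empirical average of $\Xi$ in which the largest $\chi_k$ fraction of samples is set to $0$. Equivalently, it is the expectation of the distribution on $[0,\infty)$ whose cdf is $x\mapsto\min\{1,F_\Xi(x)+\chi_k\}$ for $x\ge 0$ (and $0$ for $x<0$), i.e. $\mathcal{A}(\Xi,\gamma)=\int_0^\infty(1-\min\{1,F_\Xi(x)+\chi_k\})\,\mathrm{d}x$. **Limit-PAC lower bounds.** For a random variable $X$, a procedure $\mathcal{A}$ yields limit-PAC lower bounds on $\mathbb{E}(X)$ if, for any confidence level $\gamma\in(0,1)$, the following two conditions hold: (i) for a collection $\Xi$ of independent samples drawn from $X$ (of any size), $\mathbb{P}(\mathcal{A}(\Xi,\gamma)\le\mathbb{E}(X))\ge\gamma$; (ii) for any precision $\varepsilon>0$ there exists a threshold $k_0$ such that for every collection $\Xi$ of independent samples drawn from $X$ with $|\Xi|\ge k_0$, $\mathbb{P}(\mathbb{E}(X)-\varepsilon\le\mathcal{A}(\Xi,\gamma)\le\mathbb{E}(X))\ge\gamma$. Here $X=\mathit{PR}$. *)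

theory Defs
  imports "HOL-Probability.Probability"
begin

section \<open>Discrete-time Markov chains and their path measure\<close>

locale dtmc =
  fixes S :: "'s set" and R :: "'s \<Rightarrow> real" and T :: "'s \<Rightarrow> 's pmf" and s\<^sub>I :: 's
  assumes finite_states: "finite S"
    and initial_state: "s\<^sub>I \<in> S"
    and transitions_closed: "\<And>s. s \<in> S \<Longrightarrow> set_pmf (T s) \<subseteq> S"
    and reward_nonneg: "\<And>s. s \<in> S \<Longrightarrow> 0 \<le> R s"

text \<open>Law of the \<open>i\<close>-th state of a path, given the states before it.\<close>

definition step_kernel :: "('s \<Rightarrow> 's pmf) \<Rightarrow> 's \<Rightarrow> nat \<Rightarrow> (nat \<Rightarrow> 's) \<Rightarrow> 's measure" where
  "step_kernel T s\<^sub>I i \<omega> = measure_pmf (case i of 0 \<Rightarrow> return_pmf s\<^sub>I | Suc j \<Rightarrow> T (\<omega> j))"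

interpretation IT: Ionescu_Tulcea "step_kernel T s\<^sub>I" "\<lambda>_. count_space UNIV"
  for T :: "'s \<Rightarrow> 's pmf" and s\<^sub>I :: 's
proof (rule Ionescu_Tulcea.intro)
  show "step_kernel T s\<^sub>I i \<in> measurable (PiM {0..<i} (\<lambda>_. count_space UNIV))
    (subprob_algebra (count_space UNIV))" for i
  proof (cases i)
    case 0
    then show ?thesis
      by (simp add: step_kernel_def[abs_def] space_subprob_algebra
          measure_pmf.subprob_space_axioms)
  next
    case (Suc j)
    have *: "(\<lambda>\<omega>. \<omega> j) \<in> measurable (PiM {0..<i} (\<lambda>_. count_space UNIV)) (count_space UNIV)"
      by (rule measurable_component_singleton) (simp add: Suc)
    have "(\<lambda>s. measure_pmf (T s)) \<in> measurable (count_space UNIV) (subprob_algebra (count_space UNIV))"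
      by (simp add: space_subprob_algebra measure_pmf.subprob_space_axioms)
    from measurable_compose[OF * this] show ?thesis
      by (simp add: step_kernel_def[abs_def] Suc)
  qed
  show "prob_space (step_kernel T s\<^sub>I i \<omega>)" for i \<omega>
    by (simp add: step_kernel_def measure_pmf.prob_space_axioms)
qed

text \<open>The measure lives on all state sequences; those that are not paths of the chain form a
  null set.\<close>

definition path_measure :: "('s \<Rightarrow> 's pmf) \<Rightarrow> 's \<Rightarrow> (nat \<Rightarrow> 's) measure" where
  "path_measure T s\<^sub>I = IT.PF.lim T s\<^sub>I"

lemma space_path_measure: "space (path_measure T s\<^sub>I) = UNIV"
  by (simp add: path_measure_def space_PiM)

lemma sets_path_measure: "sets (path_measure T s\<^sub>I) = sets (PiM UNIV (\<lambda>_. count_space UNIV))"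
  by (simp add: path_measure_def)

lemma emeasure_C_cylinder:
  "emeasure (IT.C T s\<^sub>I 0 n (\<lambda>_. undefined)) (PiE {0..<n} (\<lambda>i. {s i})) =
    (\<Prod>i<n. ennreal (pmf (case i of 0 \<Rightarrow> return_pmf s\<^sub>I | Suc j \<Rightarrow> T (s j)) (s i)))"
proof (induction n)
  case 0
  then show ?case
    by (simp add: space_PiM PiM_empty)
next
  case (Suc n)
  let ?M = "\<lambda>n. PiM {0..<n} (\<lambda>_. count_space UNIV) :: (nat \<Rightarrow> 'a) measure"
  let ?A = "\<lambda>n. PiE {0..<n} (\<lambda>i. {s i})"
  let ?u = "\<lambda>_. undefined"
  let ?q = "\<lambda>i. ennreal (pmf (case i of 0 \<Rightarrow> return_pmf s\<^sub>I | Suc j \<Rightarrow> T (s j)) (s i))"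
  have A[measurable]: "?A m \<in> sets (?M m)" for m
    by (rule sets_PiM_I_finite) auto
  have u: "?u \<in> space (?M 0)"
    by (simp add: space_PiM)
  have step: "emeasure (IT.eP T s\<^sub>I n \<omega>) (?A (Suc n)) = ?q n * indicator (?A n) \<omega>"
    if "\<omega> \<in> space (?M n)" for \<omega>
  proof -
    have e: "fun_upd \<omega> n -` ?A (Suc n) = (if \<omega> \<in> ?A n then {s n} else {})"
      using that by (auto simp: space_PiM PiE_iff extensional_def less_Suc_eq split: if_splits)
    show ?thesis
      using that
      by (subst IT.emeasure_eP[OF that A])
         (auto simp: e step_kernel_def emeasure_pmf_single PiE_iff split: nat.split)
  qed
  have "emeasure (IT.C T s\<^sub>I 0 (Suc n) ?u) (?A (Suc n)) =
      (\<integral>\<^sup>+\<omega>. emeasure (IT.eP T s\<^sub>I n \<omega>) (?A (Suc n)) \<partial>IT.C T s\<^sub>I 0 n ?u)"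
    using u IT.space_C[OF u, where m=n and T=T and s\<^sub>I=s\<^sub>I]
    by (simp, subst emeasure_bind[where N="?M (Suc n)"])
       (simp_all add: measurable_cong_sets[OF IT.sets_C[OF u, of T s\<^sub>I n] refl] prob_space.not_empty)
  also have "\<dots> = (\<integral>\<^sup>+\<omega>. ?q n * indicator (?A n) \<omega> \<partial>IT.C T s\<^sub>I 0 n ?u)"
    by (intro nn_integral_cong step) (simp add: IT.space_C[OF u])
  also have "\<dots> = ?q n * emeasure (IT.C T s\<^sub>I 0 n ?u) (?A n)"
    by (subst nn_integral_cmult_indicator) (simp_all add: IT.sets_C[OF u])
  finally show ?case
    by (simp only: Suc.IH) (simp add: mult.commute)
qed

lemma emeasure_cylinder:
  "emeasure (path_measure T s\<^sub>I) {\<pi>. \<forall>i\<le>n. \<pi> i = s i} =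
    (if s 0 = s\<^sub>I then ennreal (\<Prod>i<n. pmf (T (s i)) (s (Suc i))) else 0)"
proof -
  let ?J = "{0..<Suc n}"
  let ?A = "PiE ?J (\<lambda>i. {s i})"
  have A: "?A \<in> sets (PiM ?J (\<lambda>_. count_space UNIV))"
    by (rule sets_PiM_I_finite) auto
  have "{\<pi>. \<forall>i\<le>n. \<pi> i = s i} = prod_emb UNIV (\<lambda>_. count_space UNIV) ?J ?A"
    by (auto simp: prod_emb_def space_PiM PiE_iff)
  then have "emeasure (path_measure T s\<^sub>I) {\<pi>. \<forall>i\<le>n. \<pi> i = s i} = emeasure (IT.CI T s\<^sub>I ?J) ?A"
    by (simp add: path_measure_def IT.lim[OF _ A])
  also have "\<dots> = emeasure (IT.C T s\<^sub>I 0 (Suc n) (\<lambda>_. undefined)) ?A"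
    using prod_emb_id[of ?A ?J "\<lambda>_. count_space UNIV"]
    by (subst IT.emeasure_CI[OF subset_refl A]) (simp add: PiE_mono)
  also have "\<dots> = (if s 0 = s\<^sub>I then ennreal (\<Prod>i<n. pmf (T (s i)) (s (Suc i))) else 0)"
    unfolding emeasure_C_cylinder prod.lessThan_Suc_shift
    by (simp add: prod_ennreal prod_nonneg pmf_return indicator_def)
  finally show ?thesis .
qed


section \<open>Reachability reward\<close>

definition hit_index :: "'s set \<Rightarrow> (nat \<Rightarrow> 's) \<Rightarrow> enat" where
  "hit_index G \<pi> = (INF i\<in>{i. \<pi> i \<in> G}. enat i)"

definition path_reward :: "('s \<Rightarrow> real) \<Rightarrow> 's set \<Rightarrow> (nat \<Rightarrow> 's) \<Rightarrow> ennreal" where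
  "path_reward R G \<pi> = (\<Sum>i. if enat i \<le> hit_index G \<pi> then ennreal (R (\<pi> i)) else 0)"

definition reach_reward :: "('s \<Rightarrow> real) \<Rightarrow> ('s \<Rightarrow> 's pmf) \<Rightarrow> 's \<Rightarrow> 's set \<Rightarrow> ennreal" where
  "reach_reward R T s\<^sub>I G =
    (if measure (path_measure T s\<^sub>I) {\<pi> \<in> space (path_measure T s\<^sub>I). hit_index G \<pi> = \<infinity>} > 0 then \<infinity>
     else (\<integral>\<^sup>+ \<pi>. path_reward R G \<pi> \<partial>path_measure T s\<^sub>I))"


section \<open>The lower-bound procedure\<close>

definition ecdf :: "real list \<Rightarrow> real \<Rightarrow> real" where
  "ecdf \<Xi> x = real (card {i. i < length \<Xi> \<and> \<Xi> ! i \<le> x}) / real (length \<Xi>)"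

definition dkw_width :: "nat \<Rightarrow> real \<Rightarrow> real" where
  "dkw_width k \<gamma> = sqrt (ln (2 / (1 - \<gamma>)) / (2 * real k))"

text \<open>The expectation of the distribution on \<open>[0, \<infinity>)\<close> whose cumulative distribution function is
  the shifted empirical one. The integrand vanishes beyond the largest sample, so the integral
  exists for every nonempty \<open>\<Xi>\<close>.\<close>

definition dkw_E_lower :: "real list \<Rightarrow> real \<Rightarrow> real" where
  "dkw_E_lower \<Xi> \<gamma> = (LBINT x:{0..}. 1 - min 1 (ecdf \<Xi> x + dkw_width (length \<Xi>) \<gamma>))"


section \<open>Limit-PAC lower bounds\<close>

text \<open>Probability that a list of \<open>k\<close> independent samples of \<open>X\<close> satisfies \<open>Q\<close>; the samples are
  realised on the \<open>k\<close>-fold power of the probability space of \<open>X\<close>.\<close>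

definition iid_prob :: "'a measure \<Rightarrow> ('a \<Rightarrow> real) \<Rightarrow> nat \<Rightarrow> (real list \<Rightarrow> bool) \<Rightarrow> real" where
  "iid_prob M X k Q =
    measure (PiM {..<k} (\<lambda>_. M))
      {\<omega> \<in> space (PiM {..<k} (\<lambda>_. M)). Q (map (\<lambda>i. X (\<omega> i)) [0..<k])}"

text \<open>\<open>\<mu>\<close> stands for the expectation of \<open>X\<close>. The first two conjuncts say so; integrability is
  listed because the Bochner integral of a non-integrable function is \<open>0\<close>.\<close>

definition limit_PAC_lower_bounds ::
    "(real list \<Rightarrow> real \<Rightarrow> real) \<Rightarrow> 'a measure \<Rightarrow> ('a \<Rightarrow> real) \<Rightarrow> real \<Rightarrow> bool" where
  "limit_PAC_lower_bounds \<A> M X \<mu> \<longleftrightarrow>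
    integrable M X \<and> \<mu> = (\<integral>x. X x \<partial>M) \<and>
    (\<forall>\<gamma>. 0 < \<gamma> \<and> \<gamma> < 1 \<longrightarrow>
      (\<forall>k>0. iid_prob M X k (\<lambda>\<Xi>. \<A> \<Xi> \<gamma> \<le> \<mu>) \<ge> \<gamma>) \<and>
      (\<forall>\<epsilon>>0. \<exists>k\<^sub>0>0. \<forall>k\<ge>k\<^sub>0. iid_prob M X k (\<lambda>\<Xi>. \<mu> - \<epsilon> \<le> \<A> \<Xi> \<gamma> \<and> \<A> \<Xi> \<gamma> \<le> \<mu>) \<ge> \<gamma>))"

end

theory Submission
  imports Defs "HOL-Real_Asymp.Real_Asymp"
begin

text \<open>
  Writing \<open>F\<close> for the cdf and \<open>F\<^sub>k\<close> for the empirical cdf of \<open>k\<close> samples, the output of the procedure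
  is below the expectation as soon as \<open>F - \<chi>\<^sub>k \<le> F\<^sub>k\<close> everywhere. Since
  \<open>exp (- 2 k \<chi>\<^sub>k\<^sup>2) = (1 - \<gamma>) / 2\<close>, the one-sided Dvoretzky--Kiefer--Wolfowitz inequality with Massart's
  constant \<open>1\<close> gives this with probability at least \<open>1 - (1 - \<gamma>) / 2\<close>. The remaining \<open>(1 - \<gamma>) / 2\<close>
  pays for tightness: the output is at least the empirical mean of the samples truncated at \<open>\<tau>\<close>, minus
  \<open>\<chi>\<^sub>k \<tau>\<close>, and for fixed large \<open>\<tau>\<close> this is close to the expectation by Hoeffding's inequality.

  The one-sided inequality is proved by change of measure. For a threshold \<open>x\<close>, reweight each sample by
  \<open>1 / (1 + c)\<close> below \<open>x\<close> and by a constant above \<open>x\<close>. When \<open>F\<^sub>k x < F x - \<epsilon>\<close> the likelihood ratio is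
  at least \<open>exp (2 k \<epsilon>\<^sup>2)\<close>, for one \<open>c\<close> that depends only on \<open>\<epsilon>\<close>. The tilted measures of two thresholds
  agree on events observed up to the smaller one, so the tilted probabilities of the disjoint events
  ``the first violation is at \<open>x\<close>'' sum to at most \<open>1\<close>.
\<close>

section \<open>The tilting constant\<close>

text \<open>The expression tends to \<open>0\<close> as \<open>v\<close> decreases to
  \<open>0\<close>, and its derivative is a square over a positive denominator. In
  \<open>dkw_tilt_exists\<close> it is twice the slack
  \<open>K - ln (1 + c) - 2 * \<epsilon>\<^sup>2\<close>.\<close>

lemma dkw_gap_nonneg:
  fixes v :: real
  assumes "v > 0"
  shows "2 * v * (cosh v / sinh v) - v\<^sup>2 / (sinh v)\<^sup>2 - 1 - 2 * ln (cosh v) \<ge> 0"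
proof -
  define D :: "real \<Rightarrow> real" where
    "D = (\<lambda>v. 2 * v * (cosh v / sinh v) - v\<^sup>2 / (sinh v)\<^sup>2 - 1 - 2 * ln (cosh v))"
  have deriv: "(D has_real_derivative 2 * (sinh x - x * cosh x)\<^sup>2 / (sinh x ^ 3 * cosh x)) (at x)"
    if "x > 0" for x
  proof -
    have s: "sinh x > 0" and c: "cosh x > 0"
      using that by (simp_all add: cosh_real_pos)
    have "(D has_real_derivative
        2 * (cosh x / sinh x) + 2 * x * ((sinh x * sinh x - cosh x * cosh x) / (sinh x)\<^sup>2)
        - (2 * x * (sinh x)\<^sup>2 - x\<^sup>2 * (2 * sinh x * cosh x)) / (sinh x)^4 - 2 * (sinh x / cosh x)) (at x)"
      unfolding D_def using s c
      by (auto intro!: derivative_eq_intros simp: power2_eq_square power4_eq_xxxx)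
        (simp add: field_simps)
    moreover have "2 * (cosh x / sinh x) + 2 * x * ((sinh x * sinh x - cosh x * cosh x) / (sinh x)\<^sup>2)
        - (2 * x * (sinh x)\<^sup>2 - x\<^sup>2 * (2 * sinh x * cosh x)) / (sinh x)^4 - 2 * (sinh x / cosh x)
        = 2 * (sinh x - x * cosh x)\<^sup>2 / (sinh x ^ 3 * cosh x)" (is "?l = ?r")
    proof -
      have h: "cosh x * cosh x = 1 + sinh x * sinh x"
        using cosh_square_eq[of x] by (simp add: power2_eq_square)
      have "?l * (sinh x ^ 4 * cosh x) = 2 * (cosh x)\<^sup>2 * sinh x ^ 3
          + 2 * x * ((sinh x)\<^sup>2 - (cosh x)\<^sup>2) * (sinh x)\<^sup>2 * cosh x
          - (2 * x * (sinh x)\<^sup>2 - x\<^sup>2 * (2 * sinh x * cosh x)) * cosh x - 2 * sinh x ^ 5"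
        using s c by (simp add: field_simps power2_eq_square eval_nat_numeral)
      also have "\<dots> = 2 * (sinh x - x * cosh x)\<^sup>2 * sinh x"
        using h by algebra
      also have "\<dots> = ?r * (sinh x ^ 4 * cosh x)"
        using s c by (simp add: field_simps eval_nat_numeral)
      finally have "?l * (sinh x ^ 4 * cosh x) = ?r * (sinh x ^ 4 * cosh x)" .
      then show ?thesis using s c by (subst (asm) mult_cancel_right) auto
    qed
    ultimately show ?thesis by simp
  qed
  have lim: "(D \<longlongrightarrow> 0) (at_right 0)"
    unfolding D_def sinh_field_def cosh_field_def by real_asymp
  have "D v \<ge> 0"
  proof (rule tendsto_upperbound[OF lim])
    show "\<forall>\<^sub>F x in at_right 0. D x \<le> D v"
      unfolding eventually_at_right_field
    proof (intro exI[of _ v] conjI allI impI)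
      fix x :: real assume "0 < x" "x < v"
      show "D x \<le> D v"
      proof (rule DERIV_nonneg_imp_nondecreasing[of x v D])
        show "x \<le> v" using \<open>x < v\<close> by simp
        fix y assume "x \<le> y"
        then have "y > 0" using \<open>0 < x\<close> by simp
        moreover from this have "2 * (sinh y - y * cosh y)\<^sup>2 / (sinh y ^ 3 * cosh y) \<ge> 0"
          by (simp add: cosh_real_nonneg)
        ultimately show "\<exists>d. (D has_real_derivative d) (at y) \<and> 0 \<le> d"
          using deriv by blast
      qed
    qed (use assms in auto)
  qed simp
  then show ?thesis by (simp add: D_def)
qed

text \<open>The difference \<open>f\<close> of the two sides vanishes at \<open>0\<close> and, by
  \<open>touch\<close> and \<open>tangent\<close>, has a double zero at \<open>m\<close>. The
  numerator of its derivative is quadratic, which leaves one shape only: \<open>f\<close> rises from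
  \<open>0\<close>, falls back to \<open>0\<close> at \<open>m\<close>, and rises again.\<close>

lemma ln_ge_fraction_of_tangent:
  fixes c \<epsilon> K m x :: real
  assumes pos: "c > 0" "\<epsilon> > 0" "m > 0" "x \<ge> 0"
    and touch: "ln (1 + c * m) = K * m / (1 + \<epsilon> * m)"
    and tangent: "c * (1 + \<epsilon> * m)\<^sup>2 = K * (1 + c * m)"
  shows "K * x / (1 + \<epsilon> * x) \<le> ln (1 + c * x)"
proof -
  define f where "f = (\<lambda>x. ln (1 + c * x) - K * x / (1 + \<epsilon> * x))"
  define q where "q = (\<lambda>x. c * (1 + \<epsilon> * x)\<^sup>2 - K * (1 + c * x))"
  have deriv: "(f has_real_derivative q y / ((1 + c * y) * (1 + \<epsilon> * y)\<^sup>2)) (at y)" if "y \<ge> 0" for y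
  proof -
    have p: "1 + c * y > 0" "1 + \<epsilon> * y > 0"
      using that pos by (simp_all add: add_pos_nonneg)
    have "(f has_real_derivative c / (1 + c * y) - K / (1 + \<epsilon> * y)\<^sup>2) (at y)"
      unfolding f_def using p
      by (auto intro!: derivative_eq_intros simp: power2_eq_square)
        (simp add: field_simps)
    moreover have "c / (1 + c * y) - K / (1 + \<epsilon> * y)\<^sup>2 = q y / ((1 + c * y) * (1 + \<epsilon> * y)\<^sup>2)"
      using p unfolding q_def by (subst diff_frac_eq) auto
    ultimately show ?thesis by simp
  qed
  have f0: "f 0 = 0" "f m = 0"
    using touch by (simp_all add: f_def)
  have q0: "q m = 0"
    using tangent by (simp add: q_def)
  \<comment> \<open>Besides \<open>m\<close>, the quadratic numerator \<open>q\<close> of the derivative has a root in \<open>(0, m)\<close> by Rolle, which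
    fixes the signs of \<open>q\<close>.\<close>
  have "\<exists>\<rho>. 0 < \<rho> \<and> \<rho> < m \<and> q \<rho> = 0"
  proof -
    have "\<exists>\<rho>>0. \<rho> < m \<and> f m - f 0 = (m - 0) * (q \<rho> / ((1 + c * \<rho>) * (1 + \<epsilon> * \<rho>)\<^sup>2))"
      by (rule MVT2) (use pos deriv in auto)
    then obtain \<rho> where r: "0 < \<rho>" "\<rho> < m" "q \<rho> / ((1 + c * \<rho>) * (1 + \<epsilon> * \<rho>)\<^sup>2) = 0"
      using f0 pos by auto
    have "1 + c * \<rho> > 0" "1 + \<epsilon> * \<rho> > 0"
      using r pos by (simp_all add: add_pos_pos)
    with r show ?thesis by auto
  qed
  then obtain \<rho> where r: "0 < \<rho>" "\<rho> < m" "q \<rho> = 0" by blast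
  \<comment> \<open>The leading coefficient of \<open>q\<close> is
    \<open>c * \<epsilon>\<^sup>2\<close>, so subtracting the product leaves an affine function of
    \<open>y\<close>. The identity below is its interpolation from the values at \<open>m\<close>
    and \<open>\<rho>\<close>, both zero.\<close>
  have q: "q y = c * \<epsilon>\<^sup>2 * (y - m) * (y - \<rho>)" for y
  proof -
    have "(q y - c * \<epsilon>\<^sup>2 * (y - m) * (y - \<rho>)) * (m - \<rho>) = q m * (y - \<rho>) - q \<rho> * (y - m)"
      unfolding q_def by (simp add: algebra_simps power2_eq_square)
    with q0 r show ?thesis by simp
  qed
  have pos': "(1 + c * y) * (1 + \<epsilon> * y)\<^sup>2 > 0" if "y \<ge> 0" for y
    using that pos by (intro mult_pos_pos zero_less_power) (simp_all add: add_pos_nonneg)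
  have up: "f a \<le> f b" if "0 \<le> a" "a \<le> b" "b \<le> \<rho> \<or> m \<le> a" for a b
  proof (rule DERIV_nonneg_imp_nondecreasing[OF \<open>a \<le> b\<close>])
    fix y assume y: "a \<le> y" "y \<le> b"
    have "(y - m) * (y - \<rho>) \<ge> 0"
      using that y r by (auto intro: mult_nonneg_nonneg mult_nonpos_nonpos)
    then have "q y \<ge> 0"
      using pos by (simp add: q mult.assoc)
    with deriv[of y] pos'[of y] that y show "\<exists>d. (f has_real_derivative d) (at y) \<and> 0 \<le> d"
      by (intro exI[of _ "q y / ((1 + c * y) * (1 + \<epsilon> * y)\<^sup>2)"]) simp
  qed
  have down: "f b \<le> f a" if "\<rho> \<le> a" "a \<le> b" "b \<le> m" for a b
  proof (rule DERIV_nonpos_imp_nonincreasing[OF \<open>a \<le> b\<close>])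
    fix y assume y: "a \<le> y" "y \<le> b"
    have "(y - m) * (y - \<rho>) \<le> 0"
      using that y r by (auto intro: mult_nonpos_nonneg)
    then have "q y \<le> 0"
      using pos by (simp add: q mult.assoc mult_nonneg_nonpos)
    with deriv[of y] pos'[of y] that y r show "\<exists>d. (f has_real_derivative d) (at y) \<and> d \<le> 0"
      by (intro exI[of _ "q y / ((1 + c * y) * (1 + \<epsilon> * y)\<^sup>2)"]) (simp add: divide_nonpos_pos)
  qed
  \<comment> \<open>Three ranges: before \<open>\<rho>\<close> compare with \<open>f 0 = 0\<close>,
    between \<open>\<rho>\<close> and \<open>m\<close> and beyond \<open>m\<close> compare with
    \<open>f m = 0\<close>.\<close>
  have "f x \<ge> 0"
    using up[of 0 x] down[of x m] up[of m x] f0 pos r by linarith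
  then show ?thesis by (simp add: f_def)
qed

text \<open>Here \<open>s\<close> is the mass above a threshold. A violation puts more than a
  fraction \<open>s + \<epsilon>\<close> of the samples there, so the left side bounds the
  log-likelihood ratio per sample from below. That \<open>c\<close> is chosen before
  \<open>s\<close> lets all thresholds share one tilt below them.\<close>

lemma dkw_tilt_exists:
  fixes \<epsilon> :: real
  assumes "\<epsilon> > 0"
  obtains c where "c > 0" "\<And>s. s > 0 \<Longrightarrow> (s + \<epsilon>) * ln (1 + c / s) - ln (1 + c) \<ge> 2 * \<epsilon>\<^sup>2"
proof -
  \<comment> \<open>\<open>\<epsilon>\<close> and \<open>c = (exp (2 v) - 1) / 2\<close> are parametrised by \<open>v\<close> so that \<open>(s + \<epsilon>) ln (1 + c / s)\<close> is
    minimal exactly at \<open>s = 1 / 2\<close>, with value \<open>K = v\<^sup>2 (coth v + 1)\<close>.\<close>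
  have "\<exists>v. \<epsilon> \<le> v \<and> v \<le> \<epsilon> + 1/2 \<and> (v * (cosh v / sinh v) + v - 1) / 2 = \<epsilon>"
  proof (rule IVT')
    \<comment> \<open>The left endpoint needs
      \<open>\<epsilon> * exp (- \<epsilon>) \<le> sinh \<epsilon>\<close>, which is
      \<open>1 + 2 * \<epsilon> \<le> exp (2 * \<epsilon>)\<close> rescaled. At the right endpoint,
      replacing the quotient \<open>cosh / sinh\<close> by its lower bound \<open>1\<close> leaves
      exactly \<open>\<epsilon>\<close>.\<close>
    have "\<epsilon> * cosh \<epsilon> \<le> (1 + \<epsilon>) * sinh \<epsilon>"
    proof -
      have "\<epsilon> * exp (- \<epsilon>) \<le> (exp (2 * \<epsilon>) - 1) / 2 * exp (- \<epsilon>)"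
      proof (rule mult_right_mono)
        have "1 + 2 * \<epsilon> \<le> exp (2 * \<epsilon>)" by (rule exp_ge_add_one_self)
        then show "\<epsilon> \<le> (exp (2 * \<epsilon>) - 1) / 2" by argo
      qed simp
      also have "\<dots> = sinh \<epsilon>"
        by (simp add: sinh_field_def left_diff_distrib flip: exp_add)
      finally have "\<epsilon> * (cosh \<epsilon> - sinh \<epsilon>) \<le> sinh \<epsilon>"
        by (simp add: cosh_minus_sinh)
      then show ?thesis by (simp add: algebra_simps)
    qed
    then show "(\<epsilon> * (cosh \<epsilon> / sinh \<epsilon>) + \<epsilon> - 1) / 2 \<le> \<epsilon>"
      using assms by (simp add: field_simps)
    let ?v = "\<epsilon> + 1/2"
    have "cosh ?v / sinh ?v \<ge> 1"
      using assms sinh_less_cosh_real[of ?v] by (simp add: less_imp_le)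
    then have "?v * (cosh ?v / sinh ?v) \<ge> ?v * 1"
      using assms by (intro mult_left_mono) auto
    then show "\<epsilon> \<le> (?v * (cosh ?v / sinh ?v) + ?v - 1) / 2"
      by simp
    show "continuous_on {\<epsilon>..\<epsilon> + 1/2} (\<lambda>v. (v * (cosh v / sinh v) + v - 1) / 2)"
      using assms by (intro continuous_intros) auto
  qed auto
  then obtain v where v: "v \<ge> \<epsilon>" and \<epsilon>: "\<epsilon> = (v * (cosh v / sinh v) + v - 1) / 2"
    by metis
  have v0: "v > 0" using v assms by linarith
  have s: "sinh v > 0" and ch: "cosh v > 0"
    using v0 by (simp_all add: cosh_real_pos)
  define C where "C = cosh v / sinh v"
  define c where "c = exp v * sinh v"
  define K where "K = v\<^sup>2 * (C + 1)"
  have c: "1 + c = exp v * cosh v" "1 + 2 * c = exp (2 * v)"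
    using exp_double[of v]
    by (simp_all add: c_def sinh_field_def cosh_field_def field_simps exp_minus power2_eq_square)
  have c0: "c > 0" using s by (simp add: c_def)
  have e: "1 + 2 * \<epsilon> = v * (C + 1)"
    using s by (simp add: \<epsilon> C_def field_simps)
  have C1: "C + 1 = exp v / sinh v"
    using s by (simp add: C_def field_simps cosh_plus_sinh)
  have "K - ln (1 + c) - 2 * \<epsilon>\<^sup>2 \<ge> 0"
  proof -
    have "ln (1 + c) = v + ln (cosh v)"
      using ch by (simp add: c ln_mult)
    moreover have C2: "C\<^sup>2 = 1 + 1 / (sinh v)\<^sup>2"
      using s by (simp add: C_def power_divide cosh_square_eq field_simps)
    have "2 * v * C - v\<^sup>2 / (sinh v)\<^sup>2 - 1 - 2 * ln (cosh v) \<ge> 0"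
      using dkw_gap_nonneg[OF v0] by (simp add: C_def)
    moreover have "v\<^sup>2 / (sinh v)\<^sup>2 = v\<^sup>2 * C\<^sup>2 - v\<^sup>2"
      by (simp add: C2 algebra_simps)
    moreover have "2 * \<epsilon>\<^sup>2 = (v * C + v - 1)\<^sup>2 / 2"
      by (simp add: \<epsilon> C_def power_divide)
    ultimately show ?thesis
      by (simp add: K_def power2_eq_square algebra_simps)
  qed
  moreover have "(s + \<epsilon>) * ln (1 + c / s) \<ge> K" if "s > 0" for s
  proof -
    \<comment> \<open>In the variable \<open>1 / s\<close> the left side is
      \<open>K / (s + \<epsilon>)\<close>, and the minimum at \<open>s = 1 / 2\<close> becomes
      contact at \<open>m = 2\<close>. Both contact conditions reduce to
      \<open>1 + 2 * \<epsilon> = v * (C + 1)\<close> and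
      \<open>1 + 2 * c = exp (2 * v)\<close>.\<close>
    have "K * (1/s) / (1 + \<epsilon> * (1/s)) \<le> ln (1 + c * (1/s))"
    proof (rule ln_ge_fraction_of_tangent[where m = 2])
      have "c * (v * (C + 1))\<^sup>2 = K * exp (2 * v)"
        using s exp_double[of v] by (simp add: K_def C1 c_def power2_eq_square field_simps)
      then show "c * (1 + \<epsilon> * 2)\<^sup>2 = K * (1 + c * 2)"
        using e c by (simp add: mult.commute)
      have "2 * v * (v * (C + 1)) = K * 2" by (simp add: K_def power2_eq_square)
      moreover have "v * (C + 1) > 0" using e assms by linarith
      ultimately have "2 * v = K * 2 / (v * (C + 1))"
        by (simp add: field_simps)
      then show "ln (1 + c * 2) = K * 2 / (1 + \<epsilon> * 2)"
        using e c by (simp add: mult.commute)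
    qed (use c0 assms that in auto)
    also have "K * (1/s) / (1 + \<epsilon> * (1/s)) = K / (s + \<epsilon>)"
      using that assms by (simp add: field_simps)
    finally show ?thesis
      using that assms by (simp add: field_simps)
  qed
  ultimately have "(s + \<epsilon>) * ln (1 + c / s) - ln (1 + c) \<ge> 2 * \<epsilon>\<^sup>2" if "s > 0" for s
    using that by force
  with c0 show ?thesis using that by blast
qed

section \<open>The one-sided Dvoretzky--Kiefer--Wolfowitz inequality\<close>

text \<open>Supplies the likelihood ratio of a whole sample. On a rectangle the weighted indicator
  is a product over coordinates, so its integral factors, and the values on rectangles determine a
  product measure.\<close>

lemma PiM_density:
  fixes w :: "'a \<Rightarrow> ennreal"
  assumes "sigma_finite_measure M" "prob_space (density M w)" "finite I"
    and [measurable]: "w \<in> borel_measurable M"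
  shows "PiM I (\<lambda>_. density M w) = density (PiM I (\<lambda>_. M)) (\<lambda>\<omega>. \<Prod>i\<in>I. w (\<omega> i))"
proof -
  interpret M: product_sigma_finite "\<lambda>_. M"
    using assms(1) by (simp add: product_sigma_finite_def)
  interpret W: product_sigma_finite "\<lambda>_. density M w"
    using assms(2) by (simp add: product_sigma_finite_def prob_space_imp_sigma_finite)
  have "density (PiM I (\<lambda>_. M)) (\<lambda>\<omega>. \<Prod>i\<in>I. w (\<omega> i)) = PiM I (\<lambda>_. density M w)"
  proof (rule W.PiM_eqI)
    fix A assume "\<And>i. i \<in> I \<Longrightarrow> A i \<in> sets (density M w)"
    then have A[measurable]: "\<And>i. i \<in> I \<Longrightarrow> A i \<in> sets M" by simp
    have "emeasure (density (PiM I (\<lambda>_. M)) (\<lambda>\<omega>. \<Prod>i\<in>I. w (\<omega> i))) (PiE I A) =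
        (\<integral>\<^sup>+\<omega>. (\<Prod>i\<in>I. w (\<omega> i)) * indicator (PiE I A) \<omega> \<partial>PiM I (\<lambda>_. M))"
    proof (rule emeasure_density)
      show "(\<lambda>\<omega>. \<Prod>i\<in>I. w (\<omega> i)) \<in> borel_measurable (PiM I (\<lambda>_. M))"
        by measurable
      show "PiE I A \<in> sets (PiM I (\<lambda>_. M))"
        using assms(3) A by (rule sets_PiM_I_finite)
    qed
    also have "\<dots> = (\<integral>\<^sup>+\<omega>. (\<Prod>i\<in>I. w (\<omega> i) * indicator (A i) (\<omega> i)) \<partial>PiM I (\<lambda>_. M))"
    proof (intro nn_integral_cong)
      fix \<omega> assume "\<omega> \<in> space (PiM I (\<lambda>_. M))"
      then have "indicator (PiE I A) \<omega> = (\<Prod>i\<in>I. indicator (A i) (\<omega> i) :: ennreal)"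
        using assms(3) by (auto simp: indicator_def space_PiM PiE_iff)
      then show "(\<Prod>i\<in>I. w (\<omega> i)) * indicator (PiE I A) \<omega> = (\<Prod>i\<in>I. w (\<omega> i) * indicator (A i) (\<omega> i))"
        by (simp add: prod.distrib)
    qed
    also have "\<dots> = (\<Prod>i\<in>I. \<integral>\<^sup>+x. w x * indicator (A i) x \<partial>M)"
      using assms(3) by (intro M.product_nn_integral_prod) auto
    also have "\<dots> = (\<Prod>i\<in>I. emeasure (density M w) (A i))"
      by (intro prod.cong) (simp_all add: emeasure_density)
    finally show "emeasure (density (PiM I (\<lambda>_. M)) (\<lambda>\<omega>. \<Prod>i\<in>I. w (\<omega> i))) (PiE I A) =
      (\<Prod>i\<in>I. emeasure (density M w) (A i))" .
  next
    show "sets (density (PiM I (\<lambda>_. M)) (\<lambda>\<omega>. \<Prod>i\<in>I. w (\<omega> i))) = sets (PiM I (\<lambda>_. density M w))"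
      unfolding sets_density by (intro sets_PiM_cong) auto
  qed fact
  then show ?thesis by (rule sym)
qed

section \<open>Tilted laws on the real line\<close>

context real_distribution
begin

text \<open>With \<open>s = prob {x<..} > 0\<close> the total mass is
  \<open>((1 - s) + (s + c)) / (1 + c) = 1\<close>. For \<open>s = 0\<close> the quotient
  \<open>c / s\<close> is \<open>0\<close> by convention and the mass drops to
  \<open>1 / (1 + c)\<close>, hence the positivity assumptions below. The weight at or below
  \<open>x\<close> is the same for every threshold.\<close>

definition tilt_weight :: "real \<Rightarrow> real \<Rightarrow> real \<Rightarrow> real" where
  "tilt_weight c x y = (if y \<le> x then 1 else 1 + c / prob {x<..}) / (1 + c)"

definition tilted :: "real \<Rightarrow> real \<Rightarrow> real measure" where
  "tilted c x = density M (\<lambda>y. ennreal (tilt_weight c x y))"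

lemma tilt_weight_measurable[measurable]: "tilt_weight c x \<in> borel_measurable borel"
  unfolding tilt_weight_def[abs_def] by measurable

lemma tilt_weight_nonneg: "c > 0 \<Longrightarrow> 0 \<le> tilt_weight c x y"
  by (simp add: tilt_weight_def)

lemma sets_tilted[simp, measurable_cong]: "sets (tilted c x) = sets borel"
  by (simp add: tilted_def)

lemma space_tilted[simp]: "space (tilted c x) = UNIV"
  by (simp add: tilted_def)

lemma prob_greaterThan: "prob {x<..} = 1 - cdf M x"
proof -
  have "{x<..} = space M - {..x}" by auto
  then show ?thesis by (simp add: prob_compl cdf_def del: space_eq_univ)
qed

lemma emeasure_tilted:
  assumes c: "c > 0" and [measurable]: "B \<in> sets borel"
  shows "emeasure (tilted c x) B =
    ennreal ((prob (B \<inter> {..x}) + (1 + c / prob {x<..}) * prob (B \<inter> {x<..})) / (1 + c))"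
proof -
  have "emeasure (tilted c x) B = (\<integral>\<^sup>+y. ennreal (tilt_weight c x y) * indicator B y \<partial>M)"
    unfolding tilted_def by (rule emeasure_density) auto
  also have "\<dots> = (\<integral>\<^sup>+y. ennreal (1 / (1 + c)) * indicator (B \<inter> {..x}) y
      + ennreal ((1 + c / prob {x<..}) / (1 + c)) * indicator (B \<inter> {x<..}) y \<partial>M)"
    by (intro nn_integral_cong) (auto simp: tilt_weight_def indicator_def)
  also have "\<dots> = ennreal (1 / (1 + c)) * emeasure M (B \<inter> {..x})
      + ennreal ((1 + c / prob {x<..}) / (1 + c)) * emeasure M (B \<inter> {x<..})"
    by (subst nn_integral_add) (auto simp: nn_integral_cmult_indicator)
  also have "\<dots> = ennreal ((prob (B \<inter> {..x}) + (1 + c / prob {x<..}) * prob (B \<inter> {x<..})) / (1 + c))"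
    using c by (simp add: emeasure_eq_measure add_divide_distrib algebra_simps flip: ennreal_mult ennreal_plus)
  finally show ?thesis .
qed

lemma prob_space_tilted:
  assumes "c > 0" "prob {x<..} > 0"
  shows "prob_space (tilted c x)"
proof
  have "(1 + c / prob {x<..}) * prob {x<..} = prob {x<..} + c"
    using assms(2) by (simp add: distrib_right)
  then have "prob {..x} + (1 + c / prob {x<..}) * prob {x<..} = 1 + c"
    using prob_greaterThan[of x] by (simp add: cdf_def)
  then show "emeasure (tilted c x) (space (tilted c x)) = 1"
    using assms(1) emeasure_tilted[of c UNIV x] by simp
qed

text \<open>At or below \<open>x\<close> both weights equal \<open>1 / (1 + c)\<close>. Since both
  measures have total mass \<open>1\<close>, they also agree on \<open>{x<..}\<close> as a whole,
  and the map keeps no more information than that about points above \<open>x\<close>.\<close>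

lemma distr_tilted_eq:
  assumes c: "c > 0" and "x \<le> z" "prob {z<..} > 0"
  shows "distr (tilted c x) M (\<lambda>y. if y \<le> x then y else x + 1)
    = distr (tilted c z) M (\<lambda>y. if y \<le> x then y else x + 1)"
    (is "distr _ _ ?g = _")
proof (rule measure_eqI)
  have "prob {z<..} \<le> prob {x<..}"
    using \<open>x \<le> z\<close> by (intro finite_measure_mono) auto
  then have pos: "prob {x<..} > 0" using assms by linarith
  interpret X: prob_space "tilted c x" using c pos by (rule prob_space_tilted)
  interpret Z: prob_space "tilted c z" using c assms(3) by (rule prob_space_tilted)
  have below: "emeasure (tilted c x) B = emeasure (tilted c z) B" if "B \<in> sets borel" "B \<subseteq> {..x}" for B
  proof -
    have "B \<inter> {x<..} = {}" "B \<inter> {z<..} = {}" "B \<inter> {..x} = B" "B \<inter> {..z} = B"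
      using that(2) \<open>x \<le> z\<close> by auto
    then show ?thesis using c that(1) by (simp add: emeasure_tilted)
  qed
  have above: "emeasure (tilted c x) {x<..} = emeasure (tilted c z) {x<..}"
  proof -
    have *: "{x<..} = UNIV - {..x}" by auto
    show ?thesis
      using below[of "{..x}"] emeasure_compl[of "{..x}" "tilted c x"] emeasure_compl[of "{..x}" "tilted c z"]
        X.emeasure_space_1 Z.emeasure_space_1
      unfolding * by simp
  qed
  fix B assume "B \<in> sets (distr (tilted c x) M ?g)"
  then have B[measurable]: "B \<in> sets borel" by simp
  have [measurable]: "?g \<in> borel_measurable borel" by measurable
  have pre: "?g -` B = (B \<inter> {..x}) \<union> (if x + 1 \<in> B then {x<..} else {})"
    by (auto split: if_splits)
  have "emeasure (distr (tilted c u) M ?g) B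
    = emeasure (tilted c u) (B \<inter> {..x}) + (if x + 1 \<in> B then emeasure (tilted c u) {x<..} else 0)" for u
  proof -
    have "emeasure (distr (tilted c u) M ?g) B = emeasure (tilted c u) (?g -` B)"
      by (subst emeasure_distr) auto
    also have "\<dots> = emeasure (tilted c u) (B \<inter> {..x}) + emeasure (tilted c u) (if x + 1 \<in> B then {x<..} else {})"
      unfolding pre by (intro plus_emeasure[symmetric]) auto
    finally show ?thesis by simp
  qed
  then show "emeasure (distr (tilted c x) M ?g) B = emeasure (distr (tilted c z) M ?g) B"
    using below[of "B \<inter> {..x}"] above by simp
qed simp

section \<open>Threshold crossings and their probability\<close>

text \<open>The violation of the cdf bound at \<open>x\<close>, cleared of the division by
  \<open>n\<close>; for \<open>n = 0\<close> it is false.\<close>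

definition crosses :: "nat \<Rightarrow> real \<Rightarrow> real \<Rightarrow> (nat \<Rightarrow> real) \<Rightarrow> bool" where
  "crosses n \<epsilon> x \<omega> \<longleftrightarrow> real (card {i\<in>{..<n}. \<omega> i \<le> x}) < real n * (cdf M x - \<epsilon>)"

lemma crosses_measurable[measurable]:
  "Measurable.pred (PiM {..<n} (\<lambda>_. M)) (crosses n \<epsilon> x)"
proof -
  have "crosses n \<epsilon> x = (\<lambda>\<omega>. (\<Sum>i<n. if \<omega> i \<le> x then 1 else 0) < real n * (cdf M x - \<epsilon>))"
    by (simp add: crosses_def fun_eq_iff flip: sum.inter_filter)
  also have "Measurable.pred (PiM {..<n} (\<lambda>_. M)) \<dots>"
    by measurable
  finally show ?thesis .
qed

text \<open>The log-likelihood ratio is \<open>L\<close> times the number of samples above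
  \<open>x\<close>, minus \<open>n * ln (1 + c)\<close>. It increases with that number because
  \<open>L \<ge> 0\<close>, and a crossing makes the number exceed
  \<open>n * (s + \<epsilon>)\<close>.\<close>

lemma likelihood_ge_of_crosses:
  assumes c: "c > 0" "\<And>s. s > 0 \<Longrightarrow> (s + \<epsilon>) * ln (1 + c / s) - ln (1 + c) \<ge> 2 * \<epsilon>\<^sup>2"
    and pos: "prob {x<..} > 0" and cross: "crosses n \<epsilon> x \<omega>"
  shows "exp (2 * real n * \<epsilon>\<^sup>2) \<le> (\<Prod>i<n. tilt_weight c x (\<omega> i))"
proof -
  define s where "s = prob {x<..}"
  define L where "L = ln (1 + c / s)"
  define N where "N = card {i\<in>{..<n}. \<omega> i \<le> x}"
  have "s > 0" using pos by (simp add: s_def)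
  have F: "cdf M x = 1 - s" using prob_greaterThan[of x] by (simp add: s_def)
  then have p: "1 + c / s > 0" "1 + c > 0" "1 + c / s \<ge> 1"
    using c(1) \<open>s > 0\<close> by (simp_all add: add_pos_pos)
  have L: "L \<ge> 0" using p by (simp add: L_def)
  have "card {i\<in>{..<n}. \<not> \<omega> i \<le> x} = n - N"
  proof -
    have "{i\<in>{..<n}. \<not> \<omega> i \<le> x} = {..<n} - {i\<in>{..<n}. \<omega> i \<le> x}" by auto
    then show ?thesis unfolding N_def by (simp only:) (subst card_Diff_subset, auto)
  qed
  moreover have "N \<le> card {..<n}"
    unfolding N_def by (intro card_mono) auto
  ultimately have card: "real (card {i\<in>{..<n}. \<not> \<omega> i \<le> x}) = real n - real N"
    by simp
  have *: "tilt_weight c x y = exp ((if \<not> y \<le> x then L else 0) - ln (1 + c))" for y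
    using p by (simp add: tilt_weight_def L_def s_def exp_diff)
  have "(\<Prod>i<n. tilt_weight c x (\<omega> i)) = exp (\<Sum>i<n. (if \<not> \<omega> i \<le> x then L else 0) - ln (1 + c))"
    unfolding * by (simp add: exp_sum)
  also have "\<dots> \<ge> exp (2 * real n * \<epsilon>\<^sup>2)"
  proof -
    have "(\<Sum>i<n. (if \<not> \<omega> i \<le> x then L else 0) - ln (1 + c)) = (real n - real N) * L - real n * ln (1 + c)"
      using card by (simp add: sum_subtractf flip: sum.inter_filter)
    also have "\<dots> \<ge> real n * (s + \<epsilon>) * L - real n * ln (1 + c)"
    proof -
      have "real n * (s + \<epsilon>) \<le> real n - real N"
        using cross F unfolding crosses_def N_def by (simp add: algebra_simps)
      then show ?thesis using L by (simp add: mult_right_mono)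
    qed
    also have "real n * (s + \<epsilon>) * L - real n * ln (1 + c) = real n * ((s + \<epsilon>) * L - ln (1 + c))"
      by (simp add: algebra_simps)
    also have "\<dots> \<ge> real n * (2 * \<epsilon>\<^sup>2)"
      using c(2)[OF \<open>s > 0\<close>] by (intro mult_left_mono) (simp_all add: L_def)
    finally show ?thesis by (simp add: mult.commute mult.left_commute)
  qed
  finally show ?thesis .
qed

text \<open>The event splits by the least crossed threshold into disjoint sets \<open>A x\<close>.
  Each has \<open>P\<close>-mass at most \<open>exp (- 2 * real n * \<epsilon>\<^sup>2)\<close>
  times its mass under its own tilt \<open>Q x\<close>, and there \<open>Q x\<close> may be replaced
  by \<open>Q z\<close> for the largest threshold \<open>z\<close>. Under this single probability
  measure the masses sum to at most \<open>1\<close>, so the number of thresholds does not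
  enter.\<close>

lemma finite_crossing_bound:
  assumes "\<epsilon> > 0" "finite X" and pos: "\<And>x. x \<in> X \<Longrightarrow> prob {x<..} > 0"
  shows "measure (PiM {..<n} (\<lambda>_. M)) {\<omega> \<in> space (PiM {..<n} (\<lambda>_. M)). \<exists>x\<in>X. crosses n \<epsilon> x \<omega>}
    \<le> exp (- 2 * real n * \<epsilon>\<^sup>2)"
proof (cases "X = {}")
  case False
  obtain c where c: "c > 0" "\<And>s. s > 0 \<Longrightarrow> (s + \<epsilon>) * ln (1 + c / s) - ln (1 + c) \<ge> 2 * \<epsilon>\<^sup>2"
    using dkw_tilt_exists[OF \<open>\<epsilon> > 0\<close>] by blast
  define P where "P = PiM {..<n} (\<lambda>_. M)"
  define Q where "Q = (\<lambda>x. PiM {..<n} (\<lambda>_. tilted c x))"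
  define z where "z = Max X"
  have z: "z \<in> X" "\<And>x. x \<in> X \<Longrightarrow> x \<le> z"
    using \<open>finite X\<close> False by (simp_all add: z_def)
  define first where "first = (\<lambda>x \<omega>. crosses n \<epsilon> x \<omega> \<and> (\<forall>y\<in>{y\<in>X. y < x}. \<not> crosses n \<epsilon> y \<omega>))"
  define A where "A = (\<lambda>x. {\<omega> \<in> space P. first x \<omega>})"
  interpret P: prob_space P
    unfolding P_def by (intro prob_space_PiM prob_space_axioms)
  interpret Q: prob_space "Q z"
    unfolding Q_def using z pos c by (intro prob_space_PiM prob_space_tilted)
  have sets_Q: "sets (Q x) = sets P" for x
    unfolding Q_def P_def by (intro sets_PiM_cong) auto
  have [measurable]: "A x \<in> sets P" for x
  proof -
    have "finite {y\<in>X. y < x}" using \<open>finite X\<close> by simp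
    then show ?thesis unfolding A_def first_def P_def by measurable
  qed
  have likelihood: "ennreal (exp (2 * real n * \<epsilon>\<^sup>2)) * emeasure P (A x) \<le> emeasure (Q x) (A x)"
    if "x \<in> X" for x
  proof -
    have "Q x = density P (\<lambda>\<omega>. \<Prod>i<n. ennreal (tilt_weight c x (\<omega> i)))"
      unfolding Q_def P_def tilted_def
      using prob_space_tilted[OF c(1) pos[OF that]]
      by (intro PiM_density) (auto simp: tilted_def intro: sigma_finite_measure_axioms)
    moreover have "(\<lambda>\<omega>. \<Prod>i<n. ennreal (tilt_weight c x (\<omega> i))) \<in> borel_measurable P"
      unfolding P_def by measurable
    ultimately have "emeasure (Q x) (A x) = (\<integral>\<^sup>+\<omega>. (\<Prod>i<n. ennreal (tilt_weight c x (\<omega> i))) * indicator (A x) \<omega> \<partial>P)"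
      by (simp add: emeasure_density)
    also have "\<dots> \<ge> (\<integral>\<^sup>+\<omega>. ennreal (exp (2 * real n * \<epsilon>\<^sup>2)) * indicator (A x) \<omega> \<partial>P)"
    proof (intro nn_integral_mono)
      fix \<omega>
      have "ennreal (exp (2 * real n * \<epsilon>\<^sup>2)) \<le> (\<Prod>i<n. ennreal (tilt_weight c x (\<omega> i)))" if "\<omega> \<in> A x"
        using that likelihood_ge_of_crosses[OF c pos[OF \<open>x \<in> X\<close>], of n \<omega>] c(1)
        by (simp add: A_def first_def prod_ennreal tilt_weight_nonneg ennreal_leI)
      then show "ennreal (exp (2 * real n * \<epsilon>\<^sup>2)) * indicator (A x) \<omega>
          \<le> (\<Prod>i<n. ennreal (tilt_weight c x (\<omega> i))) * indicator (A x) \<omega>"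
        by (auto simp: indicator_def)
    qed
    finally show ?thesis by (simp add: nn_integral_cmult_indicator)
  qed
  \<comment> \<open>\<open>A x\<close> does not see the exact values of samples above \<open>x\<close>, so they may be collapsed to one point by \<open>g\<close>.\<close>
  have stopped: "emeasure (Q x) (A x) = emeasure (Q z) (A x)" if "x \<in> X" for x
  proof -
    define g where "g = (\<lambda>y::real. if y \<le> x then y else x + 1)"
    have g[measurable]: "g \<in> borel_measurable borel" unfolding g_def by measurable
    have g_le: "g y \<le> u \<longleftrightarrow> y \<le> u" if "u \<le> x" for y u
      using that by (auto simp: g_def)
    have cr: "crosses n \<epsilon> u (compose {..<n} g \<omega>) \<longleftrightarrow> crosses n \<epsilon> u \<omega>" if "u \<le> x" for u \<omega>
      using g_le[OF that] by (simp add: crosses_def compose_def cong: conj_cong)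
    have "first x (compose {..<n} g \<omega>) \<longleftrightarrow> first x \<omega>" for \<omega>
      by (auto simp: first_def cr)
    \<comment> \<open>Values of \<open>compose {..<n} g\<close> are always extensional, so they lie
      in \<open>space P\<close>, and the preimage of \<open>A x\<close> is decided by
      \<open>first\<close> alone.\<close>
    moreover have "space P = extensional {..<n}"
      by (auto simp: P_def space_PiM PiE_def)
    ultimately have pre: "compose {..<n} g -` A x \<inter> space P = A x"
      by (auto simp: A_def)
    have "emeasure (Q u) (A x) = emeasure (PiM {..<n} (\<lambda>_. distr (tilted c u) M g)) (A x)" if "u \<in> X" for u
    proof -
      have "distr (Q u) P (compose {..<n} g) = PiM {..<n} (\<lambda>_. distr (tilted c u) M g)"
        unfolding Q_def P_def using that pos c g
        by (intro distr_PiM_finite_prob_space') (auto intro: prob_space_tilted prob_space_axioms)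
      moreover have "compose {..<n} g \<in> measurable (Q u) P"
        unfolding Q_def P_def compose_def by measurable
      ultimately show ?thesis
        using pre emeasure_distr[of "compose {..<n} g" "Q u" P "A x"] sets_eq_imp_space_eq[OF sets_Q, of u]
        by simp
    qed
    then show ?thesis
      using distr_tilted_eq[OF c(1) z(2)[OF that] pos[OF z(1)]] that z(1)
      by (simp add: g_def)
  qed
  have E: "{\<omega> \<in> space P. \<exists>x\<in>X. crosses n \<epsilon> x \<omega>} = (\<Union>x\<in>X. A x)"
  proof (intro equalityI subsetI)
    fix \<omega> assume "\<omega> \<in> {\<omega> \<in> space P. \<exists>x\<in>X. crosses n \<epsilon> x \<omega>}"
    then have \<omega>: "\<omega> \<in> space P" and ne: "{x\<in>X. crosses n \<epsilon> x \<omega>} \<noteq> {}" by auto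
    have fin: "finite {x\<in>X. crosses n \<epsilon> x \<omega>}" using \<open>finite X\<close> by simp
    define x where "x = Min {x\<in>X. crosses n \<epsilon> x \<omega>}"
    have "x \<in> X" "crosses n \<epsilon> x \<omega>"
      using Min_in[OF fin ne] by (simp_all add: x_def)
    moreover have "\<not> crosses n \<epsilon> y \<omega>" if "y \<in> X" "y < x" for y
      using Min_le[OF fin, of y] that by (auto simp: x_def)
    ultimately show "\<omega> \<in> (\<Union>x\<in>X. A x)"
      using \<omega> by (auto simp: A_def first_def)
  qed (auto simp: A_def first_def)
  have disj: "disjoint_family_on A X"
    unfolding disjoint_family_on_def
  proof (intro ballI impI)
    fix x y assume "x \<in> X" "y \<in> X" "x \<noteq> y"
    then show "A x \<inter> A y = {}"
      by (cases "x < y") (auto simp: A_def first_def)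
  qed
  have "ennreal (exp (2 * real n * \<epsilon>\<^sup>2)) * emeasure P (\<Union>x\<in>X. A x)
      = (\<Sum>x\<in>X. ennreal (exp (2 * real n * \<epsilon>\<^sup>2)) * emeasure P (A x))"
    using \<open>finite X\<close> disj by (subst sum_emeasure[symmetric]) (auto simp: sum_distrib_left)
  also have "\<dots> \<le> (\<Sum>x\<in>X. emeasure (Q z) (A x))"
    using likelihood stopped by (intro sum_mono) simp
  also have "\<dots> = emeasure (Q z) (\<Union>x\<in>X. A x)"
    using \<open>finite X\<close> disj sets_Q by (intro sum_emeasure) auto
  also have "\<dots> \<le> 1"
    using Q.measure_le_1 .
  finally have "ennreal (exp (2 * real n * \<epsilon>\<^sup>2) * P.prob (\<Union>x\<in>X. A x)) \<le> ennreal 1"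
    by (simp add: P.emeasure_eq_measure ennreal_mult)
  then have "exp (2 * real n * \<epsilon>\<^sup>2) * P.prob (\<Union>x\<in>X. A x) \<le> 1"
    by (subst (asm) ennreal_le_iff) auto
  then have "P.prob (\<Union>x\<in>X. A x) \<le> exp (- 2 * real n * \<epsilon>\<^sup>2)"
    by (simp add: exp_minus field_simps)
  then show ?thesis unfolding E[symmetric] by (simp add: P_def)
qed simp

text \<open>Passes from finitely many thresholds to all reals: finite sets exhaust the rationals,
  and continuity from below keeps the bound. A crossing at a real \<open>x\<close> is also one at a
  rational slightly to the right, where the sample count is unchanged and the cdf has not decreased.
  The exceptional set is a measurable \<open>B\<close> containing all crossings, so the uncountable
  union itself is never measured.\<close>

theorem one_sided_dkw:
  assumes "\<epsilon> > 0"
  obtains B where "B \<in> sets (PiM {..<n} (\<lambda>_. M))"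
    "measure (PiM {..<n} (\<lambda>_. M)) B \<le> exp (- 2 * real n * \<epsilon>\<^sup>2)"
    "\<And>\<omega> x. \<omega> \<in> space (PiM {..<n} (\<lambda>_. M)) - B \<Longrightarrow> \<not> crosses n \<epsilon> x \<omega>"
proof -
  define P where "P = PiM {..<n} (\<lambda>_. M)"
  interpret P: prob_space P
    unfolding P_def by (intro prob_space_PiM prob_space_axioms)
  define q where "q = (\<lambda>k. real_of_rat (from_nat_into UNIV k))"
  define X where "X = (\<lambda>m. {x \<in> q ` {..<m}. prob {x<..} > 0})"
  define E where "E = (\<lambda>m. {\<omega> \<in> space P. \<exists>x\<in>X m. crosses n \<epsilon> x \<omega>})"
  \<comment> \<open>Thresholds with no mass above them cannot be tilted; they are violated only on the null set \<open>Z\<close>.\<close>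
  define Z where "Z = {\<omega> \<in> space P. \<exists>i\<in>{..<n}. \<exists>k. prob {q k<..} = 0 \<and> q k < \<omega> i}"
  have [measurable]: "finite (X m)" "E m \<in> sets P" for m
  proof -
    show "finite (X m)" by (simp add: X_def)
    then show "E m \<in> sets P" unfolding E_def P_def by measurable
  qed
  have [measurable]: "Z \<in> sets P" unfolding Z_def P_def by measurable
  have "P.prob Z = 0"
  proof -
    have "AE \<omega> in P. \<not> (prob {q k<..} = 0 \<and> q k < \<omega> i)" if "i < n" for i k
    proof (cases "prob {q k<..} = 0")
      case True
      have "AE y in M. \<not> q k < y"
        using True by (intro AE_I[of _ _ "{q k<..}"]) (auto simp: emeasure_eq_measure)
      then have "AE \<omega> in P. \<not> q k < \<omega> i"
        unfolding P_def using that prob_space_axioms by (intro AE_PiM_component) auto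
      then show ?thesis by simp
    qed simp
    then have "AE \<omega> in P. \<forall>i\<in>{..<n}. \<forall>k. \<not> (prob {q k<..} = 0 \<and> q k < \<omega> i)"
      by (simp add: AE_finite_all AE_all_countable)
    then have "AE \<omega> in P. \<omega> \<notin> Z" by eventually_elim (auto simp: Z_def)
    then show ?thesis by (simp add: P.prob_eq_0)
  qed
  have incE: "incseq E" by (force simp: incseq_def E_def X_def)
  have "(\<lambda>m. P.prob (E m)) \<longlonglongrightarrow> P.prob (\<Union>m. E m)"
    by (intro P.finite_Lim_measure_incseq incE) auto
  moreover have "P.prob (E m) \<le> exp (- 2 * real n * \<epsilon>\<^sup>2)" for m
    unfolding E_def P_def by (rule finite_crossing_bound[OF assms]) (auto simp: X_def)
  ultimately have "P.prob (\<Union>m. E m) \<le> exp (- 2 * real n * \<epsilon>\<^sup>2)"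
    by (intro LIMSEQ_le_const2) auto
  moreover have "P.prob ((\<Union>m. E m) \<union> Z) \<le> P.prob (\<Union>m. E m) + P.prob Z"
    by (intro measure_Un_le) auto
  ultimately have "P.prob ((\<Union>m. E m) \<union> Z) \<le> exp (- 2 * real n * \<epsilon>\<^sup>2)"
    using \<open>P.prob Z = 0\<close> by simp
  moreover have "\<not> crosses n \<epsilon> x \<omega>" if \<omega>: "\<omega> \<in> space P - ((\<Union>m. E m) \<union> Z)" for \<omega> x
  proof
    assume cr: "crosses n \<epsilon> x \<omega>"
    \<comment> \<open>\<open>r\<close> bounds a gap to the right of \<open>x\<close> that is free of
      samples; the extra point \<open>x + 1\<close> covers the case of no sample above
      \<open>x\<close>.\<close>
    obtain r where r: "x < r" "\<And>i. i < n \<Longrightarrow> x < \<omega> i \<Longrightarrow> r \<le> \<omega> i"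
    proof -
      define F where "F = insert (x + 1) {\<omega> i | i. i < n \<and> x < \<omega> i}"
      have "finite F" "F \<noteq> {}" by (simp_all add: F_def)
      then have "Min F \<in> F" "\<And>y. y \<in> F \<Longrightarrow> Min F \<le> y" by simp_all
      moreover have "x < y" if "y \<in> F" for y using that by (auto simp: F_def)
      moreover have "\<omega> i \<in> F" if "i < n" "x < \<omega> i" for i using that by (auto simp: F_def)
      ultimately show ?thesis using that[of "Min F"] by blast
    qed
    obtain t where t: "x < real_of_rat t" "real_of_rat t < r"
      using of_rat_dense[OF r(1)] by blast
    obtain k where k: "real_of_rat t = q k"
      using from_nat_into_surj[of "UNIV :: rat set" t] by (auto simp: q_def)
    have "{i \<in> {..<n}. \<omega> i \<le> q k} = {i \<in> {..<n}. \<omega> i \<le> x}"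
      using r t k by force
    moreover have "cdf M x \<le> cdf M (q k)"
      using t k by (intro cdf_nondecreasing) auto
    ultimately have crq: "crosses n \<epsilon> (q k) \<omega>"
      using cr mult_left_mono[of "cdf M x - \<epsilon>" "cdf M (q k) - \<epsilon>" "real n"]
      by (simp add: crosses_def)
    show False
    proof (cases "prob {q k<..} > 0")
      case True
      then have "q k \<in> X (Suc k)" by (auto simp: X_def)
      with crq \<omega> show False by (auto simp: E_def)
    next
      case False
      then have p: "prob {q k<..} = 0" by (simp add: zero_less_measure_iff)
      \<comment> \<open>Outside \<open>Z\<close> no sample exceeds \<open>q k\<close>, so the count
        is \<open>n\<close> while the cdf is \<open>1\<close>, which cannot be a crossing.\<close>
      then have "{i \<in> {..<n}. \<omega> i \<le> q k} = {..<n}"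
        using \<omega> by (force simp: Z_def)
      with crq p prob_greaterThan[of "q k"] have "real n < real n * (1 - \<epsilon>)"
        by (simp add: crosses_def)
      with assms show False by (simp add: algebra_simps mult_less_0_iff)
    qed
  qed
  moreover have "(\<Union>m. E m) \<union> Z \<in> sets P" by measurable
  ultimately show ?thesis
    using that[of "(\<Union>m. E m) \<union> Z"] unfolding P_def by blast
qed

end

section \<open>Bounds on the output of the procedure\<close>

lemma ecdf_eq_sum:
  assumes "length \<Xi> = k"
  shows "ecdf \<Xi> x = (\<Sum>i<k. if \<Xi> ! i \<le> x then 1 else 0) / real k"
  using assms by (simp add: ecdf_def flip: sum.inter_filter)

lemma one_minus_ecdf_eq_sum:
  assumes "length \<Xi> = k" "k > 0"
  shows "1 - ecdf \<Xi> x = (\<Sum>i<k. if x < \<Xi> ! i then 1 else 0) / real k"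
proof -
  have "(\<Sum>i<k. if \<Xi> ! i \<le> x then 1 else 0) + (\<Sum>i<k. if x < \<Xi> ! i then 1 else 0) = (\<Sum>i<k. 1 :: real)"
    unfolding sum.distrib[symmetric] by (intro sum.cong) auto
  then show ?thesis
    using assms by (simp add: ecdf_eq_sum[OF assms(1)] field_simps)
qed

lemma ecdf_measurable[measurable]: "ecdf \<Xi> \<in> borel_measurable borel"
  unfolding ecdf_eq_sum[OF refl, abs_def] by measurable

text \<open>The layer-cake formula: both sides are the product measure of the region
  \<open>0 \<le> x < X \<omega>\<close>, sliced in the two orders.\<close>

lemma nn_integral_tail:
  assumes "sigma_finite_measure M" and [measurable]: "X \<in> borel_measurable M" and "\<And>\<omega>. \<omega> \<in> space M \<Longrightarrow> 0 \<le> X \<omega>"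
  shows "(\<integral>\<^sup>+x. indicator {0..} x * emeasure M {\<omega> \<in> space M. x < X \<omega>} \<partial>lborel) = (\<integral>\<^sup>+\<omega>. ennreal (X \<omega>) \<partial>M)"
proof -
  interpret sigma_finite_measure M by fact
  interpret pair_sigma_finite lborel M ..
  have "(\<integral>\<^sup>+x. indicator {0..} x * emeasure M {\<omega> \<in> space M. x < X \<omega>} \<partial>lborel)
      = (\<integral>\<^sup>+x. \<integral>\<^sup>+\<omega>. indicator {z. 0 \<le> fst z \<and> fst z < X (snd z)} (x, \<omega>) \<partial>M \<partial>lborel)"
  proof (intro nn_integral_cong)
    fix x :: real
    have "(\<integral>\<^sup>+\<omega>. indicator {z. 0 \<le> fst z \<and> fst z < X (snd z)} (x, \<omega>) \<partial>M)
        = (\<integral>\<^sup>+\<omega>. indicator {0..} x * indicator {\<omega> \<in> space M. x < X \<omega>} \<omega> \<partial>M)"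
      by (intro nn_integral_cong) (auto simp: indicator_def)
    also have "\<dots> = indicator {0..} x * emeasure M {\<omega> \<in> space M. x < X \<omega>}"
      by (rule nn_integral_cmult_indicator) measurable
    finally show "indicator {0..} x * emeasure M {\<omega> \<in> space M. x < X \<omega>}
        = (\<integral>\<^sup>+\<omega>. indicator {z. 0 \<le> fst z \<and> fst z < X (snd z)} (x, \<omega>) \<partial>M)" ..
  qed
  also have "\<dots> = (\<integral>\<^sup>+\<omega>. \<integral>\<^sup>+x. indicator {z. 0 \<le> fst z \<and> fst z < X (snd z)} (x, \<omega>) \<partial>lborel \<partial>M)"
    by (rule Fubini'[symmetric]) measurable
  also have "\<dots> = (\<integral>\<^sup>+\<omega>. ennreal (X \<omega>) \<partial>M)"
  proof (intro nn_integral_cong)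
    fix \<omega> assume "\<omega> \<in> space M"
    then have "0 \<le> X \<omega>" by (rule assms(3))
    have "(\<integral>\<^sup>+x. indicator {z. 0 \<le> fst z \<and> fst z < X (snd z)} (x, \<omega>) \<partial>lborel)
      = (\<integral>\<^sup>+x. indicator {0..<X \<omega>} x \<partial>lborel)"
      by (intro nn_integral_cong) (auto simp: indicator_def)
    with \<open>0 \<le> X \<omega>\<close> show "(\<integral>\<^sup>+x. indicator {z. 0 \<le> fst z \<and> fst z < X (snd z)} (x, \<omega>) \<partial>lborel) = ennreal (X \<omega>)"
      by simp
  qed
  finally show ?thesis .
qed

text \<open>By \<open>dom\<close> the integrand of the output is at most the tail probability of
  \<open>X\<close>, which integrates to the expectation by \<open>nn_integral_tail\<close>.\<close>

lemma dkw_E_lower_le_of_cdf_bound: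
  assumes M: "prob_space M" and [measurable]: "integrable M X" and nonneg: "\<And>\<omega>. \<omega> \<in> space M \<Longrightarrow> 0 \<le> X \<omega>"
    and dom: "\<And>x. measure M {\<omega> \<in> space M. X \<omega> \<le> x} - dkw_width (length \<Xi>) \<gamma> \<le> ecdf \<Xi> x"
  shows "dkw_E_lower \<Xi> \<gamma> \<le> (\<integral>\<omega>. X \<omega> \<partial>M)"
proof -
  interpret prob_space M by fact
  let ?f = "\<lambda>x. indicator {0..} x *\<^sub>R (1 - min 1 (ecdf \<Xi> x + dkw_width (length \<Xi>) \<gamma>))"
  have [measurable]: "X \<in> borel_measurable M" using assms(2) by simp
  \<comment> \<open>The integrand is nonnegative, so this holds without first establishing
    integrability.\<close>
  have A: "dkw_E_lower \<Xi> \<gamma> = enn2real (\<integral>\<^sup>+x. ennreal (?f x) \<partial>lborel)"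
    unfolding dkw_E_lower_def set_lebesgue_integral_def
    by (rule integral_eq_nn_integral) (auto simp: indicator_def)
  have "(\<integral>\<^sup>+x. ennreal (?f x) \<partial>lborel) \<le> (\<integral>\<^sup>+x. indicator {0..} x * emeasure M {\<omega> \<in> space M. x < X \<omega>} \<partial>lborel)"
  proof (intro nn_integral_mono)
    fix x :: real
    have "{\<omega> \<in> space M. x < X \<omega>} = space M - {\<omega> \<in> space M. X \<omega> \<le> x}" by auto
    then have "prob {\<omega> \<in> space M. x < X \<omega>} = 1 - prob {\<omega> \<in> space M. X \<omega> \<le> x}"
      by (simp add: prob_compl)
    then have "1 - min 1 (ecdf \<Xi> x + dkw_width (length \<Xi>) \<gamma>) \<le> prob {\<omega> \<in> space M. x < X \<omega>}"
      using dom[of x] measure_nonneg[of M "{\<omega> \<in> space M. x < X \<omega>}"] by linarith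
    then show "ennreal (?f x) \<le> indicator {0..} x * emeasure M {\<omega> \<in> space M. x < X \<omega>}"
      by (auto simp: indicator_def emeasure_eq_measure intro!: ennreal_leI)
  qed
  also have "\<dots> = (\<integral>\<^sup>+\<omega>. ennreal (X \<omega>) \<partial>M)"
    using nonneg by (intro nn_integral_tail) (auto intro: sigma_finite_measure_axioms)
  also have "\<dots> = ennreal (\<integral>\<omega>. X \<omega> \<partial>M)"
    using nonneg by (intro nn_integral_eq_integral) (auto intro: assms)
  finally have "(\<integral>\<^sup>+x. ennreal (?f x) \<partial>lborel) \<le> ennreal (\<integral>\<omega>. X \<omega> \<partial>M)" .
  then have "enn2real (\<integral>\<^sup>+x. ennreal (?f x) \<partial>lborel) \<le> enn2real (ennreal (\<integral>\<omega>. X \<omega> \<partial>M))"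
    by (rule enn2real_mono) simp
  moreover have "0 \<le> (\<integral>\<omega>. X \<omega> \<partial>M)"
    using nonneg by (simp add: integral_nonneg_AE)
  ultimately show ?thesis by (simp add: A)
qed

text \<open>The shift lowers \<open>1 - ecdf \<Xi> x\<close> by at most the width. On
  \<open>[0, \<tau>)\<close> this costs at most width times \<open>\<tau>\<close>, and beyond
  \<open>\<tau>\<close> the integrand is simply bounded below by \<open>0\<close>, which truncates
  the samples.\<close>

lemma dkw_E_lower_ge_truncated_mean:
  assumes len: "length \<Xi> = k" "k > 0" and nonneg: "\<And>i. i < k \<Longrightarrow> 0 \<le> \<Xi> ! i"
    and "\<tau> \<ge> 0" "dkw_width k \<gamma> \<ge> 0"
  shows "(\<Sum>i<k. min (\<Xi> ! i) \<tau>) / real k - dkw_width k \<gamma> * \<tau> \<le> dkw_E_lower \<Xi> \<gamma>"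
proof -
  let ?c = "dkw_width k \<gamma>"
  let ?f = "\<lambda>x. indicator {0..} x *\<^sub>R (1 - min 1 (ecdf \<Xi> x + ?c))"
  let ?g = "\<lambda>x. (\<Sum>i<k. indicator {0..<\<Xi> ! i} x) / real k"
  let ?h = "\<lambda>x. (\<Sum>i<k. indicator {0..<min (\<Xi> ! i) \<tau>} x) / real k"
  let ?t = "\<lambda>x. ?c * indicator {0..<\<tau>} x"
  have int: "integrable lborel (\<lambda>x. indicator {0..<u} x :: real)" for u :: real
    by (cases "u \<ge> 0") simp_all
  have LINT: "(LINT x|lborel. indicator {0..<u} x) = u" if "u \<ge> 0" for u :: real
    using that by simp
  have g: "?g x = 1 - ecdf \<Xi> x" if "x \<ge> 0" for x
    unfolding one_minus_ecdf_eq_sum[OF len] using that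
    by (intro arg_cong2[where f = "(/)"] sum.cong) (auto simp: indicator_def)
  have ecdf_le: "ecdf \<Xi> x \<le> 1" if "x \<ge> 0" for x
  proof -
    have "?g x \<ge> 0" by (simp add: sum_nonneg)
    then show ?thesis using g[OF that] by simp
  qed
  have int_g: "integrable lborel ?g" and int_h: "integrable lborel ?h"
    by (intro integrable_divide_zero impI Bochner_Integration.integrable_sum int)+
  have int_t: "integrable lborel ?t"
    by (intro integrable_mult_right impI int)
  have "(LINT x|lborel. ?h x) = (\<Sum>i<k. min (\<Xi> ! i) \<tau>) / real k"
    using nonneg \<open>\<tau> \<ge> 0\<close>
    by (simp only: integral_divide_zero Bochner_Integration.integral_sum[OF int])
      (auto intro!: arg_cong2[where f = "(/)"] sum.cong LINT)
  moreover have "(LINT x|lborel. ?t x) = ?c * \<tau>"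
    using LINT[OF \<open>\<tau> \<ge> 0\<close>] by (simp only: integral_mult_right_zero)
  ultimately have "(\<Sum>i<k. min (\<Xi> ! i) \<tau>) / real k - ?c * \<tau> = (LINT x|lborel. ?h x - ?t x)"
    by (simp only: Bochner_Integration.integral_diff[OF int_h int_t])
  also have "\<dots> \<le> (LINT x|lborel. ?f x)"
  proof (rule integral_mono)
    show "integrable lborel (\<lambda>x. ?h x - ?t x)"
      using int_h int_t by (rule Bochner_Integration.integrable_diff)
    show "?h x - ?t x \<le> ?f x" for x
    proof (cases "0 \<le> x \<and> x < \<tau>")
      case True
      then have "?h x = ?g x" "?t x = ?c"
        by (auto simp: indicator_def intro!: arg_cong2[where f = "(/)"] sum.cong)
      then show ?thesis
        using g[of x] True by simp
    next
      case False
      then have "?h x = 0" "?t x = 0"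
        by (auto simp: indicator_def intro!: sum.neutral)
      moreover have "?f x \<ge> 0" by (simp add: indicator_def)
      ultimately show ?thesis by linarith
    qed
    \<comment> \<open>As the width is nonnegative, the shifted integrand is dominated by
      \<open>?g\<close>, a finite sum of interval indicators.\<close>
    show "integrable lborel ?f"
    proof (rule Bochner_Integration.integrable_bound[OF int_g])
      show "AE x in lborel. norm (?f x) \<le> norm (?g x)"
      proof (intro AE_I2)
        fix x :: real
        show "norm (?f x) \<le> norm (?g x)"
        proof (cases "x \<ge> 0")
          case True
          have "\<bar>1 - min 1 (ecdf \<Xi> x + ?c)\<bar> \<le> \<bar>1 - ecdf \<Xi> x\<bar>"
            using ecdf_le[OF True] \<open>?c \<ge> 0\<close> by linarith
          then show ?thesis using True by (simp only: g[OF True]) simp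
        qed (simp add: indicator_def)
      qed
    qed simp
  qed
  finally show ?thesis
    using len by (simp add: dkw_E_lower_def set_lebesgue_integral_def)
qed

text \<open>Applying \<open>X\<close> in each coordinate carries the power of \<open>M\<close> to
  the power of the law \<open>D\<close> of \<open>X\<close>, so the exceptional set is the preimage
  of the one for \<open>D\<close>.\<close>

lemma (in prob_space) dkw_samples:
  fixes X :: "'a \<Rightarrow> real"
  assumes [measurable]: "X \<in> borel_measurable M" and "\<epsilon> > 0" "n > 0"
  obtains B where "B \<in> sets (PiM {..<n} (\<lambda>_. M))"
    "measure (PiM {..<n} (\<lambda>_. M)) B \<le> exp (- 2 * real n * \<epsilon>\<^sup>2)"
    "\<And>\<omega> x. \<omega> \<in> space (PiM {..<n} (\<lambda>_. M)) - B \<Longrightarrow>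
      prob {\<omega> \<in> space M. X \<omega> \<le> x} - \<epsilon> \<le> ecdf (map (\<lambda>i. X (\<omega> i)) [0..<n]) x"
proof -
  define D where "D = distr M borel X"
  define P where "P = PiM {..<n} (\<lambda>_. M)"
  interpret D: real_distribution D
    unfolding D_def by (intro real_distribution_distr) simp
  obtain B where B: "B \<in> sets (PiM {..<n} (\<lambda>_. D))"
    "measure (PiM {..<n} (\<lambda>_. D)) B \<le> exp (- 2 * real n * \<epsilon>\<^sup>2)"
    "\<And>\<omega> x. \<omega> \<in> space (PiM {..<n} (\<lambda>_. D)) - B \<Longrightarrow> \<not> D.crosses n \<epsilon> x \<omega>"
    using D.one_sided_dkw[OF \<open>\<epsilon> > 0\<close>, of n] by blast
  define h where "h = compose {..<n} X"
  have h[measurable]: "h \<in> measurable P (PiM {..<n} (\<lambda>_. D))"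
    unfolding h_def P_def compose_def D_def by measurable
  have "distr P (PiM {..<n} (\<lambda>_. D)) h = PiM {..<n} (\<lambda>_. distr M D X)"
    unfolding h_def P_def
    by (intro distr_PiM_finite_prob_space') (use prob_space_axioms D.prob_space_axioms in \<open>simp_all add: D_def\<close>)
  moreover have "distr M D X = D"
    unfolding D_def by (intro distr_cong) auto
  ultimately have "distr P (PiM {..<n} (\<lambda>_. D)) h = PiM {..<n} (\<lambda>_. D)"
    by simp
  then have "measure P (h -` B \<inter> space P) = measure (PiM {..<n} (\<lambda>_. D)) B"
    using measure_distr[OF h B(1)] by simp
  then have "measure P (h -` B \<inter> space P) \<le> exp (- 2 * real n * \<epsilon>\<^sup>2)"
    using B(2) by simp
  moreover have "prob {\<omega> \<in> space M. X \<omega> \<le> x} - \<epsilon> \<le> ecdf (map (\<lambda>i. X (\<omega> i)) [0..<n]) x"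
    if \<omega>: "\<omega> \<in> space P - h -` B \<inter> space P" for \<omega> x
  proof -
    have "h \<omega> \<in> space (PiM {..<n} (\<lambda>_. D)) - B"
      using \<omega> measurable_space[OF h] by auto
    then have "\<not> D.crosses n \<epsilon> x (h \<omega>)" by (rule B(3))
    moreover have "cdf D x = prob {\<omega> \<in> space M. X \<omega> \<le> x}"
      unfolding cdf_def D_def by (subst measure_distr) (auto intro!: arg_cong[where f = prob])
    moreover have "card {i \<in> {..<n}. h \<omega> i \<le> x} = card {i. i < n \<and> map (\<lambda>i. X (\<omega> i)) [0..<n] ! i \<le> x}"
      by (intro arg_cong[where f = card]) (auto simp: h_def compose_def)
    ultimately show ?thesis
      using \<open>n > 0\<close> by (simp add: D.crosses_def ecdf_def not_less pos_le_divide_eq mult.commute)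
  qed
  moreover have "h -` B \<inter> space P \<in> sets P"
    using h B(1) by (rule measurable_sets)
  ultimately show ?thesis
    unfolding P_def by (intro that)
qed

section \<open>Measurability of the output and concentration of truncated means\<close>

lemma dkw_E_lower_measurable:
  assumes [measurable]: "X \<in> borel_measurable M"
  shows "(\<lambda>\<omega>. dkw_E_lower (map (\<lambda>i. X (\<omega> i)) [0..<k]) \<gamma>) \<in> borel_measurable (PiM {..<k} (\<lambda>_. M))"
proof -
  have "ecdf (map (\<lambda>i. X (\<omega> i)) [0..<k]) x = (\<Sum>i<k. if X (\<omega> i) \<le> x then 1 else 0) / real k" for \<omega> x
    by (subst ecdf_eq_sum[where k = k]) (auto intro!: arg_cong2[where f = "(/)"] sum.cong)
  then show ?thesis
    unfolding dkw_E_lower_def set_lebesgue_integral_def by simp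
qed

lemma (in prob_space) truncated_mean_concentration:
  fixes X :: "'a \<Rightarrow> real"
  assumes [measurable]: "X \<in> borel_measurable M" and nonneg: "\<And>\<omega>. \<omega> \<in> space M \<Longrightarrow> 0 \<le> X \<omega>"
    and "\<tau> > 0" "\<eta> > 0" "n > 0"
  shows "measure (PiM {..<n} (\<lambda>_. M)) {\<omega> \<in> space (PiM {..<n} (\<lambda>_. M)).
      (\<Sum>i<n. min (X (\<omega> i)) \<tau>) / real n \<le> expectation (\<lambda>\<omega>. min (X \<omega>) \<tau>) - \<eta>}
    \<le> exp (- 2 * real n * \<eta>\<^sup>2 / \<tau>\<^sup>2)"
proof -
  define P where "P = PiM {..<n} (\<lambda>_. M)"
  define m where "m = expectation (\<lambda>\<omega>. min (X \<omega>) \<tau>)"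
  interpret P: prob_space P
    unfolding P_def by (intro prob_space_PiM prob_space_axioms)
  have comp: "distr P M (\<lambda>\<omega>. \<omega> i) = M" if "i < n" for i
    unfolding P_def using that by (intro distr_PiM_component prob_space_axioms) auto
  have comp_meas[measurable]: "(\<lambda>\<omega>. \<omega> i) \<in> measurable P M" if "i < n" for i
    unfolding P_def using that by (intro measurable_component_singleton) simp
  \<comment> \<open>Independence is checked as joint law equals product of marginals; the joint map
    is the identity on \<open>space P\<close>.\<close>
  have "P.indep_vars (\<lambda>_. M) (\<lambda>i \<omega>. \<omega> i) {..<n}"
  proof (subst P.indep_vars_iff_distr_eq_PiM')
    have "distr P (PiM {..<n} (\<lambda>_. M)) (\<lambda>\<omega>. \<lambda>i\<in>{..<n}. \<omega> i) = distr P P (\<lambda>\<omega>. \<omega>)"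
      unfolding P_def by (intro distr_cong) (auto simp: space_PiM PiE_restrict)
    also have "\<dots> = PiM {..<n} (\<lambda>_. M)" by (simp add: P_def)
    also have "\<dots> = PiM {..<n} (\<lambda>i. distr P M (\<lambda>\<omega>. \<omega> i))"
      by (intro PiM_cong) (simp_all add: comp)
    finally show "distr P (PiM {..<n} (\<lambda>_. M)) (\<lambda>\<omega>. \<lambda>i\<in>{..<n}. \<omega> i)
      = PiM {..<n} (\<lambda>i. distr P M (\<lambda>\<omega>. \<omega> i))" .
  qed (use \<open>n > 0\<close> in auto)
  then have indep: "P.indep_vars (\<lambda>_. borel) (\<lambda>i \<omega>. min (X (\<omega> i)) \<tau>) {..<n}"
    by (rule P.indep_vars_compose2) measurable
  have "P.expectation (\<lambda>\<omega>. min (X (\<omega> i)) \<tau>) = m" if "i < n" for i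
  proof -
    have "m = (\<integral>\<omega>. min (X \<omega>) \<tau> \<partial>distr P M (\<lambda>\<omega>. \<omega> i))"
      by (simp add: m_def comp[OF that])
    also have "\<dots> = P.expectation (\<lambda>\<omega>. min (X (\<omega> i)) \<tau>)"
      using that by (intro integral_distr) auto
    finally show ?thesis ..
  qed
  then have mean: "(\<Sum>i<n. P.expectation (\<lambda>\<omega>. min (X (\<omega> i)) \<tau>)) = real n * m"
    by simp
  interpret Hoeffding_ineq P "{..<n}" "\<lambda>i \<omega>. min (X (\<omega> i)) \<tau>" "\<lambda>_. 0" "\<lambda>_. \<tau>" "real n * m"
  proof unfold_locales
    show "AE \<omega> in P. min (X (\<omega> i)) \<tau> \<in> {0..\<tau>}" if "i \<in> {..<n}" for i
      using that nonneg \<open>\<tau> > 0\<close>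
      by (intro AE_I2) (auto simp: P_def space_PiM PiE_iff)
  qed (use indep mean in auto)
  have "P.prob {\<omega> \<in> space P. (\<Sum>i<n. min (X (\<omega> i)) \<tau>) \<le> real n * m - real n * \<eta>}
    \<le> exp (- 2 * (real n * \<eta>)\<^sup>2 / (\<Sum>i<n. (\<tau> - 0)\<^sup>2))"
    using \<open>\<tau> > 0\<close> \<open>\<eta> > 0\<close> \<open>n > 0\<close> by (intro Hoeffding_ineq_le) auto
  also have "- 2 * (real n * \<eta>)\<^sup>2 / (\<Sum>i<n. (\<tau> - 0)\<^sup>2) = - 2 * real n * \<eta>\<^sup>2 / \<tau>\<^sup>2"
    using \<open>n > 0\<close> by (simp add: power2_eq_square)
  finally have "P.prob {\<omega> \<in> space P. (\<Sum>i<n. min (X (\<omega> i)) \<tau>) \<le> real n * m - real n * \<eta>}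
    \<le> exp (- 2 * real n * \<eta>\<^sup>2 / \<tau>\<^sup>2)" .
  moreover have "s / real n \<le> m - \<eta> \<longleftrightarrow> s \<le> real n * m - real n * \<eta>" for s
    using \<open>n > 0\<close> by (simp add: pos_divide_le_eq right_diff_distrib mult.commute)
  ultimately show ?thesis by (simp add: P_def m_def)
qed

section \<open>Calibration of the width and the limit-PAC property\<close>

lemma dkw_width_props:
  assumes "0 < \<gamma>" "\<gamma> < 1"
  shows dkw_width_pos: "k > 0 \<Longrightarrow> 0 < dkw_width k \<gamma>"
    and exp_dkw_width: "k > 0 \<Longrightarrow> exp (- 2 * real k * (dkw_width k \<gamma>)\<^sup>2) = (1 - \<gamma>) / 2"
    and dkw_width_tendsto_0: "(\<lambda>k. dkw_width k \<gamma>) \<longlonglongrightarrow> 0"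
proof -
  have l: "ln (2 / (1 - \<gamma>)) > 0" using assms by (intro ln_gt_zero) simp
  show "k > 0 \<Longrightarrow> 0 < dkw_width k \<gamma>"
    using l by (simp add: dkw_width_def)
  show "exp (- 2 * real k * (dkw_width k \<gamma>)\<^sup>2) = (1 - \<gamma>) / 2" if "k > 0"
  proof -
    have "(dkw_width k \<gamma>)\<^sup>2 = ln (2 / (1 - \<gamma>)) / (2 * real k)"
      unfolding dkw_width_def using l by (intro real_sqrt_pow2) simp
    then have "- 2 * real k * (dkw_width k \<gamma>)\<^sup>2 = - ln (2 / (1 - \<gamma>))"
      using that by simp
    then show ?thesis
      using assms by (simp add: exp_minus)
  qed
  have "(\<lambda>k. sqrt (c / (2 * real k))) \<longlonglongrightarrow> 0" if "c > 0" for c :: real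
    using that by real_asymp
  from this[OF l] show "(\<lambda>k. dkw_width k \<gamma>) \<longlonglongrightarrow> 0"
    by (simp add: dkw_width_def)
qed

lemma (in prob_space) truncated_expectation_tendsto:
  fixes X :: "'a \<Rightarrow> real"
  assumes int: "integrable M X" and nonneg: "\<And>\<omega>. \<omega> \<in> space M \<Longrightarrow> 0 \<le> X \<omega>"
  shows "(\<lambda>N. expectation (\<lambda>\<omega>. min (X \<omega>) (real N))) \<longlonglongrightarrow> expectation X"
proof (rule integral_dominated_convergence[where w = X])
  show "AE \<omega> in M. (\<lambda>N. min (X \<omega>) (real N)) \<longlonglongrightarrow> X \<omega>"
  proof (intro AE_I2 tendsto_eventually)
    fix \<omega>
    show "\<forall>\<^sub>F N in sequentially. min (X \<omega>) (real N) = X \<omega>"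
      using eventually_ge_at_top[of "nat \<lceil>X \<omega>\<rceil>"] by eventually_elim linarith
  qed
qed (use int nonneg in auto)

theorem dkw_E_lower_limit_PAC:
  assumes "prob_space M" and int: "integrable M X" and nonneg: "\<And>\<omega>. \<omega> \<in> space M \<Longrightarrow> 0 \<le> X \<omega>"
  shows "limit_PAC_lower_bounds dkw_E_lower M X (\<integral>\<omega>. X \<omega> \<partial>M)"
proof -
  interpret prob_space M by fact
  have X[measurable]: "X \<in> borel_measurable M" using int by simp
  define \<mu> where "\<mu> = (\<integral>\<omega>. X \<omega> \<partial>M)"
  define P where "P = (\<lambda>k. PiM {..<k::nat} (\<lambda>_. M))"
  define \<A> where "\<A> = (\<lambda>\<gamma> k \<omega>. dkw_E_lower (map (\<lambda>i. X (\<omega> i)) [0..<k]) \<gamma>)"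
  interpret P: prob_space "P k" for k
    unfolding P_def by (intro prob_space_PiM prob_space_axioms)
  have [measurable]: "\<A> \<gamma> k \<in> borel_measurable (P k)" for \<gamma> k
    unfolding \<A>_def P_def using X by (rule dkw_E_lower_measurable)
  \<comment> \<open>Keeping the failure set with its budget \<open>(1 - \<gamma>) / 2\<close>,
    instead of only the resulting confidence, serves both \<open>sound\<close> and the union bound
    in \<open>tight\<close>.\<close>
  have upper: "\<exists>B\<in>sets (P k). P.prob k B \<le> (1 - \<gamma>) / 2 \<and> (\<forall>\<omega>\<in>space (P k) - B. \<A> \<gamma> k \<omega> \<le> \<mu>)"
    if \<gamma>: "0 < \<gamma>" "\<gamma> < 1" and "k > 0" for \<gamma> k
  proof -
    obtain B where B: "B \<in> sets (P k)" "P.prob k B \<le> exp (- 2 * real k * (dkw_width k \<gamma>)\<^sup>2)"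
      "\<And>\<omega> x. \<omega> \<in> space (P k) - B \<Longrightarrow>
        prob {\<omega> \<in> space M. X \<omega> \<le> x} - dkw_width k \<gamma> \<le> ecdf (map (\<lambda>i. X (\<omega> i)) [0..<k]) x"
      unfolding P_def using dkw_samples[OF X dkw_width_pos[OF \<gamma> \<open>k > 0\<close>] \<open>k > 0\<close>] by blast
    have "\<A> \<gamma> k \<omega> \<le> \<mu>" if "\<omega> \<in> space (P k) - B" for \<omega>
      unfolding \<A>_def \<mu>_def using B(3)[OF that] nonneg
      by (intro dkw_E_lower_le_of_cdf_bound int prob_space_axioms) simp_all
    then show ?thesis
      using B(1,2) exp_dkw_width[OF \<gamma> \<open>k > 0\<close>] by metis
  qed
  have sound: "\<gamma> \<le> P.prob k {\<omega> \<in> space (P k). \<A> \<gamma> k \<omega> \<le> \<mu>}"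
    if \<gamma>: "0 < \<gamma>" "\<gamma> < 1" and "k > 0" for \<gamma> k
  proof -
    obtain B where B: "B \<in> sets (P k)" "P.prob k B \<le> (1 - \<gamma>) / 2" "\<forall>\<omega>\<in>space (P k) - B. \<A> \<gamma> k \<omega> \<le> \<mu>"
      using upper[OF \<gamma> \<open>k > 0\<close>] by blast
    have "1 - P.prob k B = P.prob k (space (P k) - B)"
      using P.prob_compl[OF B(1)] ..
    also have "\<dots> \<le> P.prob k {\<omega> \<in> space (P k). \<A> \<gamma> k \<omega> \<le> \<mu>}"
      using B(3) by (intro P.finite_measure_mono) auto
    finally show ?thesis using B(2) \<gamma> by simp
  qed
  have tight: "\<exists>k\<^sub>0>0. \<forall>k\<ge>k\<^sub>0. \<gamma> \<le> P.prob k {\<omega> \<in> space (P k). \<mu> - \<epsilon> \<le> \<A> \<gamma> k \<omega> \<and> \<A> \<gamma> k \<omega> \<le> \<mu>}"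
    if \<gamma>: "0 < \<gamma>" "\<gamma> < 1" and "\<epsilon> > 0" for \<gamma> \<epsilon>
  proof -
    \<comment> \<open>The precision is split in thirds: truncation bias, loss from the width, and
      deviation of the truncated mean. The level \<open>\<tau>\<close> is fixed first, so the other
      two can be made small by taking \<open>k\<close> large.\<close>
    have "\<forall>\<^sub>F N in sequentially. \<mu> - \<epsilon> / 3 < expectation (\<lambda>\<omega>. min (X \<omega>) (real N))"
    proof (rule order_tendstoD(1))
      show "(\<lambda>N. expectation (\<lambda>\<omega>. min (X \<omega>) (real N))) \<longlonglongrightarrow> \<mu>"
        unfolding \<mu>_def using int nonneg by (rule truncated_expectation_tendsto)
    qed (use \<open>\<epsilon> > 0\<close> in simp)
    then have "\<forall>\<^sub>F N in sequentially. N > 0 \<and> \<mu> - \<epsilon> / 3 < expectation (\<lambda>\<omega>. min (X \<omega>) (real N))"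
      using eventually_gt_at_top[of 0] by eventually_elim simp
    then obtain N where N: "N > 0" "\<mu> - \<epsilon> / 3 < expectation (\<lambda>\<omega>. min (X \<omega>) (real N))"
      by (auto dest: eventually_happens)
    define \<tau> where "\<tau> = real N"
    define m where "m = expectation (\<lambda>\<omega>. min (X \<omega>) \<tau>)"
    have \<tau>: "\<tau> > 0" and m: "\<mu> - \<epsilon> / 3 < m"
      using N by (simp_all add: \<tau>_def m_def)
    have "(\<lambda>k. dkw_width k \<gamma> * \<tau>) \<longlonglongrightarrow> 0"
      using dkw_width_tendsto_0[OF \<gamma>] by (rule tendsto_mult_left_zero)
    then have "\<forall>\<^sub>F k in sequentially. dkw_width k \<gamma> * \<tau> < \<epsilon> / 3"
      by (rule order_tendstoD(2)) (use \<open>\<epsilon> > 0\<close> in simp)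
    moreover have "(\<lambda>k. exp (- 2 * real k * (\<epsilon> / 3)\<^sup>2 / \<tau>\<^sup>2)) \<longlonglongrightarrow> 0"
      using \<tau> \<open>\<epsilon> > 0\<close> by real_asymp
    then have "\<forall>\<^sub>F k in sequentially. exp (- 2 * real k * (\<epsilon> / 3)\<^sup>2 / \<tau>\<^sup>2) < (1 - \<gamma>) / 2"
      by (rule order_tendstoD(2)) (use \<gamma> in simp)
    ultimately have "\<forall>\<^sub>F k in sequentially. k > 0 \<and> dkw_width k \<gamma> * \<tau> < \<epsilon> / 3 \<and>
        exp (- 2 * real k * (\<epsilon> / 3)\<^sup>2 / \<tau>\<^sup>2) < (1 - \<gamma>) / 2"
      using eventually_gt_at_top[of 0] by eventually_elim simp
    then obtain k\<^sub>0 where k\<^sub>0: "\<And>k. k \<ge> k\<^sub>0 \<Longrightarrow> k > 0 \<and> dkw_width k \<gamma> * \<tau> < \<epsilon> / 3 \<and>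
        exp (- 2 * real k * (\<epsilon> / 3)\<^sup>2 / \<tau>\<^sup>2) < (1 - \<gamma>) / 2"
      unfolding eventually_sequentially by blast
    have "\<gamma> \<le> P.prob k {\<omega> \<in> space (P k). \<mu> - \<epsilon> \<le> \<A> \<gamma> k \<omega> \<and> \<A> \<gamma> k \<omega> \<le> \<mu>}" if "k \<ge> k\<^sub>0" for k
    proof -
      have k: "k > 0" "dkw_width k \<gamma> * \<tau> < \<epsilon> / 3" "exp (- 2 * real k * (\<epsilon> / 3)\<^sup>2 / \<tau>\<^sup>2) < (1 - \<gamma>) / 2"
        using k\<^sub>0[OF that] by auto
      obtain B where B: "B \<in> sets (P k)" "P.prob k B \<le> (1 - \<gamma>) / 2" "\<forall>\<omega>\<in>space (P k) - B. \<A> \<gamma> k \<omega> \<le> \<mu>"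
        using upper[OF \<gamma> k(1)] by blast
      define C where "C = {\<omega> \<in> space (P k). (\<Sum>i<k. min (X (\<omega> i)) \<tau>) / real k \<le> m - \<epsilon> / 3}"
      have [measurable]: "C \<in> sets (P k)" unfolding C_def P_def by measurable
      have C: "P.prob k C \<le> (1 - \<gamma>) / 2"
        using truncated_mean_concentration[OF X nonneg \<tau>, of "\<epsilon> / 3" k] \<open>\<epsilon> > 0\<close> k
        by (simp add: C_def P_def m_def)
      have lower: "\<mu> - \<epsilon> \<le> \<A> \<gamma> k \<omega>" if \<omega>: "\<omega> \<in> space (P k) - C" for \<omega>
      proof -
        have "0 \<le> X (\<omega> i)" if "i < k" for i
          using \<omega> that by (intro nonneg) (auto simp: P_def space_PiM PiE_iff)
        then have "(\<Sum>i<k. min (X (\<omega> i)) \<tau>) / real k - dkw_width k \<gamma> * \<tau> \<le> \<A> \<gamma> k \<omega>"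
          using dkw_E_lower_ge_truncated_mean[of "map (\<lambda>i. X (\<omega> i)) [0..<k]" k \<tau> \<gamma>]
            dkw_width_pos[OF \<gamma> k(1)] \<tau> k(1) by (simp add: \<A>_def)
        moreover have "m - \<epsilon> / 3 < (\<Sum>i<k. min (X (\<omega> i)) \<tau>) / real k"
          using \<omega> by (auto simp: C_def)
        ultimately show ?thesis using k(2) m by linarith
      qed
      have "1 - P.prob k (B \<union> C) = P.prob k (space (P k) - (B \<union> C))"
        using B(1) by (intro P.prob_compl[symmetric]) auto
      also have "\<dots> \<le> P.prob k {\<omega> \<in> space (P k). \<mu> - \<epsilon> \<le> \<A> \<gamma> k \<omega> \<and> \<A> \<gamma> k \<omega> \<le> \<mu>}"
        using B(3) lower by (intro P.finite_measure_mono) auto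
      finally have "1 - P.prob k (B \<union> C) \<le> \<dots>" .
      moreover have "P.prob k (B \<union> C) \<le> P.prob k B + P.prob k C"
        using B(1) by (intro measure_Un_le) auto
      ultimately show ?thesis using B(2) C by (simp add: field_simps)
    qed
    \<comment> \<open>Positivity of \<open>k\<close> was put into the eventual property, which holds
      at \<open>k\<^sub>0\<close> itself.\<close>
    moreover have "k\<^sub>0 > 0" using k\<^sub>0[of k\<^sub>0] by simp
    ultimately show ?thesis by blast
  qed
  show ?thesis
    using int sound tight
    unfolding limit_PAC_lower_bounds_def iid_prob_def P_def \<A>_def \<mu>_def by blast
qed

section \<open>Path rewards\<close>

text \<open>The whole space is the cylinder over the empty index set, whose mass is that of a
  finite-dimensional marginal.\<close>

lemma prob_space_path_measure: "prob_space (path_measure T s\<^sub>I)"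
proof
  let ?M = "\<lambda>_. count_space UNIV :: 'a measure"
  interpret C: prob_space "IT.CI T s\<^sub>I {}"
    by (rule IT.PF.prob_space_P) auto
  have "emeasure (path_measure T s\<^sub>I) (prod_emb UNIV ?M {} (space (PiM {} ?M)))
      = emeasure (IT.CI T s\<^sub>I {}) (space (PiM {} ?M))"
    unfolding path_measure_def by (rule IT.lim) auto
  also have "\<dots> = 1"
    using C.emeasure_space_1 by (simp add: IT.PF.space_P)
  finally show "emeasure (path_measure T s\<^sub>I) (space (path_measure T s\<^sub>I)) = 1"
    by (simp add: prod_emb_def space_path_measure space_PiM restrict_def vimage_def)
qed

lemma path_reward_measurable: "path_reward R G \<in> borel_measurable (path_measure T s\<^sub>I)"
proof -
  have proj: "(\<lambda>\<pi>. \<pi> i) \<in> measurable (path_measure T s\<^sub>I) (count_space UNIV)" for i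
    unfolding measurable_cong_sets[OF sets_path_measure refl] by measurable
  have [measurable]: "(\<lambda>\<pi>. R (\<pi> i)) \<in> borel_measurable (path_measure T s\<^sub>I)"
      "Measurable.pred (path_measure T s\<^sub>I) (\<lambda>\<pi>. \<pi> i \<in> G)" for i
    by (rule measurable_compose[OF proj], simp)+
  \<comment> \<open>Turns the infimum into a test of finitely many coordinates; a path that misses
    \<open>G\<close> has index \<open>\<infinity>\<close> and passes for every
    \<open>i\<close>.\<close>
  have hit: "enat i \<le> hit_index G \<pi> \<longleftrightarrow> (\<forall>j<i. \<pi> j \<notin> G)" for i \<pi>
    unfolding hit_index_def le_INF_iff by (auto simp: not_less)
  show ?thesis
    unfolding path_reward_def[abs_def] hit by measurable
qed

theorem corollary2:
  fixes S :: "'s set" and R :: "'s \<Rightarrow> real" and T :: "'s \<Rightarrow> 's pmf" and s\<^sub>I :: 's and G :: "'s set"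
  assumes "dtmc S R T s\<^sub>I"
    and "G \<subseteq> S"
    and "reach_reward R T s\<^sub>I G < \<infinity>"
  shows "limit_PAC_lower_bounds dkw_E_lower
    (path_measure T s\<^sub>I) (\<lambda>\<pi>. enn2real (path_reward R G \<pi>)) (enn2real (reach_reward R T s\<^sub>I G))"
proof -
  let ?M = "path_measure T s\<^sub>I"
  let ?I = "\<integral>\<^sup>+\<pi>. path_reward R G \<pi> \<partial>?M"
  note [measurable] = path_reward_measurable[of R G T s\<^sub>I]
  \<comment> \<open>Finiteness rules out the branch in which \<open>G\<close> is missed with
    positive probability.\<close>
  have I: "reach_reward R T s\<^sub>I G = ?I" "?I < \<infinity>"
    using assms(3) by (auto simp: reach_reward_def split: if_splits)
  \<comment> \<open>Hence \<open>enn2real\<close>, which sends \<open>\<infinity>\<close> to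
    \<open>0\<close>, changes the path reward only on a null set.\<close>
  then have "AE \<pi> in ?M. path_reward R G \<pi> \<noteq> \<infinity>"
    by (intro nn_integral_PInf_AE) auto
  then have eq: "(\<integral>\<^sup>+\<pi>. ennreal (enn2real (path_reward R G \<pi>)) \<partial>?M) = ?I"
    by (intro nn_integral_cong_AE) (auto simp: less_top)
  then have int: "integrable ?M (\<lambda>\<pi>. enn2real (path_reward R G \<pi>))"
    using I(2) by (intro integrableI_nonneg) auto
  have "(\<integral>\<pi>. enn2real (path_reward R G \<pi>) \<partial>?M) = enn2real (reach_reward R T s\<^sub>I G)"
    using eq I(1) by (subst integral_eq_nn_integral) auto
  with dkw_E_lower_limit_PAC[OF prob_space_path_measure int] show ?thesis
    by simp
qed

end
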